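(* Let $\mathcal T_1\subseteq\mathcal T_2\subseteq\mathcal T_G$ be nonempty convex sets. For $i\in\{1,2\}$ let $\mathcal C_i$ be a closed convex cone and $\mathcal S_i$ a closed convex set with $\overline{\mathcal T_i}=\{\Phi\in\mathcal C_i:\sum_m\Phi_m\in\mathcal S_i\}$, $\mathcal C_1\subseteq\mathcal C_2\subseteq\mathcal C_G$, and $\mathcal S_1\subseteq\mathcal S_2\subseteq\mathcal S_G$. Let (P$_i$) denote Problem (P) with $\mathcal T=\mathcal T_i$, and (D$_i$) denote Problem (D) with $(\mathcal C,\mathcal S)=(\mathcal C_i,\mathcal S_i)$ (same data $c_m,a_{j,m},b_j$; the closure assumption on $\mathsf P$ is assumed for both). Assume the feasible set of (P$_1$) is nonempty and that (D$_2$) has an optimal solution. Consider the statements: (1) the optimal values of (P$_1$) and (P$_2$) coincide (equivalently, those of (D$_1$) and (D$_2$) coincide); (2) there is an optimal solution $(\chi^\star,q^\star)$ of (D$_1$) that is feasible for (D$_2$) and satisfies $\lambda_{\mathcal S_1}(\chi^\star)=\lambda_{\mathcal S_2}(\chi^\star)$; (3) every optimal solution of (D$_2$) is optimal for (D$_1$); (4) there is an optimal solution $(\chi^\star,q^\star)$ of (D$_1$) that is feasible for (D$_2$) and satisfies $\chi^\star\in\mathrm{Lin}(\mathrm{Chn}_{\tilde{\mathcal V}})$. Then $(1)\Leftrightarrow(2)\Rightarrow(3)$. Moreover, if $\mathcal S_2=\mathcal S_G$, then (1), (2), (3), (4) are all equivalent.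
   Context: Standing setup. All Hilbert spaces are finite-dimensional complex. Fix an integer $T\ge1$ and systems $\mathcal V_1,\dots,\mathcal V_T,\mathcal W_1,\dots,\mathcal W_T$; set $\mathcal W_0:=\mathbb C$ and $\tilde{\mathcal V}:=\mathcal W_T\otimes\mathcal V_T\otimes\cdots\otimes\mathcal W_1\otimes\mathcal V_1$. For a system $\mathcal X$, $N_{\mathcal X}$ is its dimension, $I_{\mathcal X}$ its identity, $\mathrm{Her}_{\mathcal X}$ the real Hilbert space of Hermitian operators on $\mathcal X$ with inner product $\langle X,Y\rangle=\mathrm{Tr}(XY)$, and $\mathrm{Pos}_{\mathcal X}$ the set of positive semidefinite operators; $X\ge Y$ means $X-Y$ is positive semidefinite; $\mathrm{Tr}_{\mathcal X}$ is the partial trace over $\mathcal X$. For a subset $A$ of a real vector space, $\mathrm{Lin}(A)$ is its real linear span and $\overline A$ its closure. $\mathcal I_n:=\{0,\dots,n-1\}$. Combs: $\mathrm{Chn}_{\tilde{\mathcal V}}$ is the set of $c\in\mathrm{Pos}_{\tilde{\mathcal V}}$ for which there exist $c_t\in\mathrm{Pos}_{\mathcal W_t\otimes\mathcal V_t\otimes\cdots\otimes\mathcal W_1\otimes\mathcal V_1}$ ($t=1,\dots,T$) with $c_T=c$, $\mathrm{Tr}_{\mathcal W_t}c_t=I_{\mathcal V_t}\otimes c_{t-1}$ for $2\le t\le T$, and $\mathrm{Tr}_{\mathcal W_1}c_1=I_{\mathcal V_1}$. $\mathcal S_G$ is the set of operators $I_{\mathcal W_T}\otimes\tau_T$ where $\tau_t\in\mathrm{Pos}_{\mathcal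 V_t\otimes\mathcal W_{t-1}\otimes\mathcal V_{t-1}\otimes\cdots\otimes\mathcal W_1\otimes\mathcal V_1}$ ($t=1,\dots,T$) satisfy $\mathrm{Tr}\,\tau_1=1$ and $\mathrm{Tr}_{\mathcal V_t}\tau_t=I_{\mathcal W_{t-1}}\otimes\tau_{t-1}$ for $2\le t\le T$. Fix an integer $M\ge2$; $\mathcal C_G:=\mathrm{Pos}_{\tilde{\mathcal V}}^M$ and the set of (all) testers is $\mathcal T_G:=\{\Phi=\{\Phi_m\}_{m=0}^{M-1}\in\mathcal C_G:\sum_m\Phi_m\in\mathcal S_G\}$. Problem data: an integer $J\ge0$, $c_m,a_{j,m}\in\mathrm{Her}_{\tilde{\mathcal V}}$ and $b_j\in\mathbb R$ ($m\in\mathcal I_M$, $j\in\mathcal I_J$); $\eta_j(\Phi):=\sum_m\langle\Phi_m,a_{j,m}\rangle-b_j$ and $P(\Phi):=\sum_m\langle\Phi_m,c_m\rangle$. $\mathcal T$ is a nonempty convex subset of $\mathcal T_G$, $\mathsf P:=\{\Phi\in\mathcal T:\eta_j(\Phi)\le0\ \forall j\in\mathcal I_J\}$, and it is assumed that $\overline{\mathsf P}=\{\Phi\in\overline{\mathcal T}:\eta_j(\Phi)\le0\ \forall j\}$. $\mathcal C\subseteq\mathcal C_G$ is a closed convex cone and $\mathcal S\subseteq\mathcal S_G$ a closed convex set with $\overline{\mathcal T}=\{\Phi\in\mathcal C:\sum_m\Phi_m\in\mathcal S\}$. Problem (P): maximize $P(\Phi)$ subject to $\Phi\in\mathsf P$;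 its optimal value is $\sup_{\Phi\in\mathsf P}P(\Phi)$ ($-\infty$ if $\mathsf P=\emptyset$); an optimal solution is a $\Phi\in\mathsf P$ attaining it. Dual: $\mathcal C^*:=\{\{y_m\}_{m}\in\mathrm{Her}_{\tilde{\mathcal V}}^M:\sum_m\langle\Phi_m,y_m\rangle\ge0\ \forall\Phi\in\mathcal C\}$; $\lambda_{\mathcal S}(\chi):=\sup_{\varphi\in\mathcal S}\langle\varphi,\chi\rangle$; $z_m(q):=c_m-\sum_jq_ja_{j,m}$ for $q=\{q_j\}\in\mathbb R_+^J$; $\mathsf D:=\{(\chi,q)\in\mathrm{Her}_{\tilde{\mathcal V}}\times\mathbb R_+^J:\{\chi-z_m(q)\}_{m}\in\mathcal C^*\}$; $D_{\mathcal S}(\chi,q):=\lambda_{\mathcal S}(\chi)+\sum_jq_jb_j$. Problem (D): minimize $D_{\mathcal S}(\chi,q)$ over $(\chi,q)\in\mathsf D$; its optimal value is the infimum ($+\infty$ if $\mathsf D=\emptyset$); an optimal solution attains it. *)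

theory Defs
  imports "HOL-Analysis.Analysis"
begin

text \<open>
Concrete model.  A system of dimension n has basis indices 0..n-1.  A basis index of a
composite system W_t (x) V_t (x) ... (x) W_1 (x) V_1 is the list [w_t, v_t, ..., w_1, v_1].
An operator is its matrix of entries, a function op = nat list => nat list => complex,
required to vanish outside the relevant index set.  A tuple Phi = {Phi_m}_{m<M} is a
function nat => op with Phi m = 0 for m >= M.  Topology: the product (pointwise)
topology of HOL-Analysis, which on the finite-dimensional spaces of such supported
objects is the usual Euclidean topology.
\<close>

type_synonym op = "nat list \<Rightarrow> nat list \<Rightarrow> complex"
type_synonym tup = "nat \<Rightarrow> op"

definition zero_op :: op where "zero_op = (\<lambda>i j. 0)"

definition unit_op :: op where "unit_op = (\<lambda>i j. if i = [] \<and> j = [] then 1 else 0)"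

fun idxWV :: "(nat \<Rightarrow> nat) \<Rightarrow> (nat \<Rightarrow> nat) \<Rightarrow> nat \<Rightarrow> nat list set" where
  "idxWV nV nW 0 = {[]}"
| "idxWV nV nW (Suc t) =
     {w # v # r | w v r. w < nW (Suc t) \<and> v < nV (Suc t) \<and> r \<in> idxWV nV nW t}"

definition idxV :: "(nat \<Rightarrow> nat) \<Rightarrow> (nat \<Rightarrow> nat) \<Rightarrow> nat \<Rightarrow> nat list set" where
  "idxV nV nW t = {v # r | v r. v < nV t \<and> r \<in> idxWV nV nW (t - 1)}"

definition supp_in :: "nat list set \<Rightarrow> op \<Rightarrow> bool" where
  "supp_in X A \<longleftrightarrow> (\<forall>i j. (i \<notin> X \<or> j \<notin> X) \<longrightarrow> A i j = 0)"

definition Her :: "nat list set \<Rightarrow> op \<Rightarrow> bool" where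
  "Her X A \<longleftrightarrow> supp_in X A \<and> (\<forall>i\<in>X. \<forall>j\<in>X. A j i = cnj (A i j))"

definition Pos :: "nat list set \<Rightarrow> op \<Rightarrow> bool" where
  "Pos X A \<longleftrightarrow> Her X A \<and>
     (\<forall>x :: nat list \<Rightarrow> complex. 0 \<le> Re (\<Sum>i\<in>X. \<Sum>j\<in>X. cnj (x i) * A i j * x j))"

text \<open>Hilbert--Schmidt inner product Tr(AB) (real for Hermitian A, B)\<close>
definition inner_op :: "nat list set \<Rightarrow> op \<Rightarrow> op \<Rightarrow> real" where
  "inner_op X A B = Re (\<Sum>i\<in>X. \<Sum>j\<in>X. A i j * B j i)"

definition id_tensor :: "nat \<Rightarrow> op \<Rightarrow> op" where
  "id_tensor n A = (\<lambda>i j. case (i, j) of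
      (w # r, w' # r') \<Rightarrow> if w = w' \<and> w < n then A r r' else 0
    | _ \<Rightarrow> 0)"

definition ptrace :: "nat \<Rightarrow> op \<Rightarrow> op" where
  "ptrace n A = (\<lambda>r r'. \<Sum>w<n. A (w # r) (w # r'))"

definition add_op :: "op \<Rightarrow> op \<Rightarrow> op" where "add_op A B = (\<lambda>i j. A i j + B i j)"
definition scale_op :: "real \<Rightarrow> op \<Rightarrow> op" where
  "scale_op u A = (\<lambda>i j. complex_of_real u * A i j)"
definition diff_op :: "op \<Rightarrow> op \<Rightarrow> op" where "diff_op A B = (\<lambda>i j. A i j - B i j)"

definition Chn :: "nat \<Rightarrow> (nat \<Rightarrow> nat) \<Rightarrow> (nat \<Rightarrow> nat) \<Rightarrow> op set" where
  "Chn T nV nW = {c. \<exists>cs :: nat \<Rightarrow> op. cs T = c \<and> cs 0 = unit_op \<and>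
      (\<forall>t\<in>{1..T}. Pos (idxWV nV nW t) (cs t) \<and>
                   ptrace (nW t) (cs t) = id_tensor (nV t) (cs (t - 1)))}"

definition SG :: "nat \<Rightarrow> (nat \<Rightarrow> nat) \<Rightarrow> (nat \<Rightarrow> nat) \<Rightarrow> op set" where
  "SG T nV nW = {id_tensor (nW T) (tau T) | tau :: nat \<Rightarrow> op.
      (\<forall>t\<in>{1..T}. Pos (idxV nV nW t) (tau t)) \<and>
      ptrace (nV 1) (tau 1) = unit_op \<and>
      (\<forall>t\<in>{2..T}. ptrace (nV t) (tau t) = id_tensor (nW (t - 1)) (tau (t - 1)))}"

definition sum_tup :: "nat \<Rightarrow> tup \<Rightarrow> op" where
  "sum_tup M Phi = (\<lambda>i j. \<Sum>m<M. Phi m i j)"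

definition CG :: "nat \<Rightarrow> (nat \<Rightarrow> nat) \<Rightarrow> (nat \<Rightarrow> nat) \<Rightarrow> nat \<Rightarrow> tup set" where
  "CG T nV nW M = {Phi. (\<forall>m<M. Pos (idxWV nV nW T) (Phi m)) \<and> (\<forall>m\<ge>M. Phi m = zero_op)}"

definition TG :: "nat \<Rightarrow> (nat \<Rightarrow> nat) \<Rightarrow> (nat \<Rightarrow> nat) \<Rightarrow> nat \<Rightarrow> tup set" where
  "TG T nV nW M = {Phi \<in> CG T nV nW M. sum_tup M Phi \<in> SG T nV nW}"

definition HerM :: "nat \<Rightarrow> (nat \<Rightarrow> nat) \<Rightarrow> (nat \<Rightarrow> nat) \<Rightarrow> nat \<Rightarrow> tup set" where
  "HerM T nV nW M = {y. (\<forall>m<M. Her (idxWV nV nW T) (y m)) \<and> (\<forall>m\<ge>M. y m = zero_op)}"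

definition inner_tup :: "nat \<Rightarrow> (nat \<Rightarrow> nat) \<Rightarrow> (nat \<Rightarrow> nat) \<Rightarrow> nat \<Rightarrow> tup \<Rightarrow> tup \<Rightarrow> real" where
  "inner_tup T nV nW M Phi y = (\<Sum>m<M. inner_op (idxWV nV nW T) (Phi m) (y m))"

definition convex_ops :: "op set \<Rightarrow> bool" where
  "convex_ops S \<longleftrightarrow> (\<forall>x\<in>S. \<forall>y\<in>S. \<forall>u::real. 0 \<le> u \<and> u \<le> 1 \<longrightarrow>
      add_op (scale_op u x) (scale_op (1 - u) y) \<in> S)"

definition convex_tups :: "tup set \<Rightarrow> bool" where
  "convex_tups A \<longleftrightarrow> (\<forall>x\<in>A. \<forall>y\<in>A. \<forall>u::real. 0 \<le> u \<and> u \<le> 1 \<longrightarrow>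
      (\<lambda>m. add_op (scale_op u (x m)) (scale_op (1 - u) (y m))) \<in> A)"

definition cone_tups :: "tup set \<Rightarrow> bool" where
  "cone_tups A \<longleftrightarrow> (\<forall>x\<in>A. \<forall>u::real. 0 \<le> u \<longrightarrow> (\<lambda>m. scale_op u (x m)) \<in> A)"

definition lin_span :: "op set \<Rightarrow> op set" where
  "lin_span A = {x. \<exists>F (c :: op \<Rightarrow> real). finite F \<and> F \<subseteq> A \<and>
      x = (\<lambda>i j. \<Sum>a\<in>F. complex_of_real (c a) * a i j)}"

definition dual_cone :: "nat \<Rightarrow> (nat \<Rightarrow> nat) \<Rightarrow> (nat \<Rightarrow> nat) \<Rightarrow> nat \<Rightarrow> tup set \<Rightarrow> tup set" where
  "dual_cone T nV nW M C = {y \<in> HerM T nV nW M. \<forall>Phi\<in>C. 0 \<le> inner_tup T nV nW M Phi y}"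

definition lambdaS :: "nat \<Rightarrow> (nat \<Rightarrow> nat) \<Rightarrow> (nat \<Rightarrow> nat) \<Rightarrow> op set \<Rightarrow> op \<Rightarrow> real" where
  "lambdaS T nV nW S chi = Sup ((\<lambda>phi. inner_op (idxWV nV nW T) phi chi) ` S)"

definition eta :: "nat \<Rightarrow> (nat \<Rightarrow> nat) \<Rightarrow> (nat \<Rightarrow> nat) \<Rightarrow> nat \<Rightarrow>
    (nat \<Rightarrow> nat \<Rightarrow> op) \<Rightarrow> (nat \<Rightarrow> real) \<Rightarrow> nat \<Rightarrow> tup \<Rightarrow> real" where
  "eta T nV nW M a b j Phi = inner_tup T nV nW M Phi (a j) - b j"

definition Pobj :: "nat \<Rightarrow> (nat \<Rightarrow> nat) \<Rightarrow> (nat \<Rightarrow> nat) \<Rightarrow> nat \<Rightarrow> (nat \<Rightarrow> op) \<Rightarrow> tup \<Rightarrow> real" where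
  "Pobj T nV nW M c Phi = inner_tup T nV nW M Phi c"

definition Pfeas :: "nat \<Rightarrow> (nat \<Rightarrow> nat) \<Rightarrow> (nat \<Rightarrow> nat) \<Rightarrow> nat \<Rightarrow> nat \<Rightarrow>
    (nat \<Rightarrow> nat \<Rightarrow> op) \<Rightarrow> (nat \<Rightarrow> real) \<Rightarrow> tup set \<Rightarrow> tup set" where
  "Pfeas T nV nW M J a b TT = {Phi \<in> TT. \<forall>j<J. eta T nV nW M a b j Phi \<le> 0}"

text \<open>optimal value of (P) (extended real; -infinity if infeasible)\<close>
definition Pval :: "nat \<Rightarrow> (nat \<Rightarrow> nat) \<Rightarrow> (nat \<Rightarrow> nat) \<Rightarrow> nat \<Rightarrow> nat \<Rightarrow>
    (nat \<Rightarrow> op) \<Rightarrow> (nat \<Rightarrow> nat \<Rightarrow> op) \<Rightarrow> (nat \<Rightarrow> real) \<Rightarrow> tup set \<Rightarrow> ereal" where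
  "Pval T nV nW M J c a b TT =
     (SUP Phi \<in> Pfeas T nV nW M J a b TT. ereal (Pobj T nV nW M c Phi))"

definition zq :: "nat \<Rightarrow> (nat \<Rightarrow> op) \<Rightarrow> (nat \<Rightarrow> nat \<Rightarrow> op) \<Rightarrow> (nat \<Rightarrow> real) \<Rightarrow> nat \<Rightarrow> op" where
  "zq J c a q m = (\<lambda>i k. c m i k - (\<Sum>j<J. complex_of_real (q j) * a j m i k))"

definition Dfeas :: "nat \<Rightarrow> (nat \<Rightarrow> nat) \<Rightarrow> (nat \<Rightarrow> nat) \<Rightarrow> nat \<Rightarrow> nat \<Rightarrow>
    (nat \<Rightarrow> op) \<Rightarrow> (nat \<Rightarrow> nat \<Rightarrow> op) \<Rightarrow> tup set \<Rightarrow> (op \<times> (nat \<Rightarrow> real)) set" where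
  "Dfeas T nV nW M J c a C = {(chi, q). Her (idxWV nV nW T) chi \<and>
      (\<forall>j<J. 0 \<le> q j) \<and> (\<forall>j\<ge>J. q j = 0) \<and>
      (\<lambda>m. if m < M then diff_op chi (zq J c a q m) else zero_op) \<in> dual_cone T nV nW M C}"

definition Dobj :: "nat \<Rightarrow> (nat \<Rightarrow> nat) \<Rightarrow> (nat \<Rightarrow> nat) \<Rightarrow> nat \<Rightarrow> (nat \<Rightarrow> real) \<Rightarrow>
    op set \<Rightarrow> op \<times> (nat \<Rightarrow> real) \<Rightarrow> real" where
  "Dobj T nV nW J b S p = lambdaS T nV nW S (fst p) + (\<Sum>j<J. snd p j * b j)"

definition Dopt :: "nat \<Rightarrow> (nat \<Rightarrow> nat) \<Rightarrow> (nat \<Rightarrow> nat) \<Rightarrow> nat \<Rightarrow> nat \<Rightarrow>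
    (nat \<Rightarrow> op) \<Rightarrow> (nat \<Rightarrow> nat \<Rightarrow> op) \<Rightarrow> (nat \<Rightarrow> real) \<Rightarrow> tup set \<Rightarrow> op set \<Rightarrow>
    op \<times> (nat \<Rightarrow> real) \<Rightarrow> bool" where
  "Dopt T nV nW M J c a b C S p \<longleftrightarrow> p \<in> Dfeas T nV nW M J c a C \<and>
     (\<forall>p'\<in>Dfeas T nV nW M J c a C. Dobj T nV nW J b S p \<le> Dobj T nV nW J b S p')"

end

theory Submission
  imports Defs
begin

text \<open>
  If (P) is feasible, it has the same value as (D): a number strictly above the primal value can be
  certified by the gradient of a quadratic penalty, whose minimum is attained because \<open>S\<close> is compact
  and \<open>C\<close> consists of positive tuples.  Passing from index 2 to index 1 enlarges the dual feasible
  set and lowers \<open>\<lambda>\<^sub>S\<close>, so if the values agree, every optimal solution of the second dual stays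
  optimal for the first one and both support functions agree on it; conversely (2) sandwiches the
  two values.

  When \<open>S2\<close> is the set of all testers, pairing with a comb is constant on \<open>S2\<close>, so (4) gives (2).
  For (3) implies (4), any \<open>chi\<close> is dominated by an operator in the span of the combs with the same
  value of \<open>\<lambda>\<^sub>S\<close>; replacing \<open>chi\<close> by it preserves dual feasibility and the objective.
\<close>

section \<open>Positive operators\<close>

text \<open>Attainment is assumed for the second dual only. Optimal points of the first dual are
  therefore produced from optimal points of the second and certified by weak duality against the
  value of the first primal. The penalty argument fits this: for a bound \<open>v\<close> strictly
  above the primal values it delivers one dual point of objective at most \<open>v\<close>, and an
  attained dual optimum exceeding the primal value is contradicted by a \<open>v\<close> strictly
  between. Feasibility of (P) enters through the multiplier of the objective, which must be positive
  before it can be divided out.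

  Combs matter for the case of all testers because a comb and an element of \<open>SG\<close> always
  pair to 1. Keeping the trace conditions of a comb but allowing Hermitian operators and a
  normalisation \<open>l\<close> of either sign gives operators that pair to the constant
  \<open>l\<close> with all of \<open>SG\<close>. Hence such an operator dominating
  \<open>chi\<close>, at the level \<open>l\<close> equal to the support function at
  \<open>chi\<close>, does not change the dual objective.\<close>

lemmas op_defs = add_op_def scale_op_def diff_op_def zero_op_def

definition quad_form :: "nat list set \<Rightarrow> op \<Rightarrow> (nat list \<Rightarrow> complex) \<Rightarrow> complex" where
  "quad_form X A x = (\<Sum>i\<in>X. \<Sum>j\<in>X. cnj (x i) * A i j * x j)"

definition rank_one :: "nat list set \<Rightarrow> (nat list \<Rightarrow> complex) \<Rightarrow> op" where
  "rank_one X x = (\<lambda>i j. if i \<in> X \<and> j \<in> X then x i * cnj (x j) else 0)"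

definition id_op :: "nat list set \<Rightarrow> op" where
  "id_op X = (\<lambda>i j. if i = j \<and> i \<in> X then 1 else 0)"

definition trace_re :: "nat list set \<Rightarrow> op \<Rightarrow> real" where
  "trace_re X A = (\<Sum>i\<in>X. Re (A i i))"

section \<open>The trace pairing and Hermitian operators\<close>

lemma inner_op_commute: "inner_op X A B = inner_op X B A"
  unfolding inner_op_def by (subst sum.swap) (simp add: mult.commute)

lemma inner_op_add_left: "inner_op X (add_op A B) C = inner_op X A C + inner_op X B C"
  by (simp add: inner_op_def add_op_def ring_distribs sum.distrib)

lemma inner_op_diff_left: "inner_op X (diff_op A B) C = inner_op X A C - inner_op X B C"
  by (simp add: inner_op_def diff_op_def ring_distribs sum_subtractf)

lemma inner_op_scale_left: "inner_op X (scale_op u A) C = u * inner_op X A C"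
proof -
  have "(\<Sum>i\<in>X. \<Sum>j\<in>X. scale_op u A i j * C j i) = complex_of_real u * (\<Sum>i\<in>X. \<Sum>j\<in>X. A i j * C j i)"
    by (simp add: scale_op_def sum_distrib_left mult.assoc)
  then show ?thesis by (simp add: inner_op_def)
qed

lemma inner_op_add_right: "inner_op X C (add_op A B) = inner_op X C A + inner_op X C B"
  using inner_op_add_left inner_op_commute by metis

lemma inner_op_diff_right: "inner_op X C (diff_op A B) = inner_op X C A - inner_op X C B"
  using inner_op_diff_left inner_op_commute by metis

lemma inner_op_scale_right: "inner_op X C (scale_op u A) = u * inner_op X C A"
  using inner_op_scale_left inner_op_commute by metis

lemma inner_op_zero [simp]: "inner_op X zero_op C = 0" "inner_op X C zero_op = 0"
  by (simp_all add: inner_op_def zero_op_def)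

lemmas inner_op_linear = inner_op_add_left inner_op_diff_left inner_op_scale_left
  inner_op_add_right inner_op_diff_right inner_op_scale_right

lemma inner_op_sum_left:
  "inner_op X (\<lambda>i j. \<Sum>k\<in>K. f k i j) C = (\<Sum>k\<in>K. inner_op X (f k) C)"
proof -
  have "(\<Sum>i\<in>X. \<Sum>j\<in>X. (\<Sum>k\<in>K. f k i j) * C j i) = (\<Sum>k\<in>K. \<Sum>i\<in>X. \<Sum>j\<in>X. f k i j * C j i)"
    unfolding sum_distrib_right sum.swap[where A = X and B = K] ..
  then show ?thesis by (simp add: inner_op_def)
qed

text \<open>Turns positivity, a statement about vectors, into one about pairings; self-duality and
  closedness of the positive cone both rest on it.\<close>

lemma inner_op_rank_one: "inner_op X A (rank_one X x) = Re (quad_form X A x)"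
  by (simp add: inner_op_def rank_one_def quad_form_def mult_ac cong: sum.cong)

text \<open>Unlike the definition, this orientation terminates as a rewrite rule.\<close>

lemma Her_iff: "Her X A \<longleftrightarrow> supp_in X A \<and> (\<forall>i j. cnj (A i j) = A j i)"
  unfolding Her_def supp_in_def by (metis complex_cnj_zero)

lemma Her_cnj: "Her X A \<Longrightarrow> A j i = cnj (A i j)"
  by (simp add: Her_iff)

lemma Her_outside: "Her X A \<Longrightarrow> i \<notin> X \<or> j \<notin> X \<Longrightarrow> A i j = 0"
  by (auto simp: Her_iff supp_in_def)

lemma Her_ops:
  assumes "Her X A" "Her X B"
  shows "Her X (add_op A B)" "Her X (diff_op A B)"
  using assms by (auto simp: Her_iff supp_in_def op_defs)

lemma Her_scale: "Her X A \<Longrightarrow> Her X (scale_op u A)"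
  by (auto simp: Her_iff supp_in_def op_defs)

lemma Her_zero [simp, intro]: "Her X zero_op"
  by (simp add: Her_iff supp_in_def zero_op_def)

lemma Her_sum: "(\<And>k. k \<in> K \<Longrightarrow> Her X (f k)) \<Longrightarrow> Her X (\<lambda>i j. \<Sum>k\<in>K. f k i j)"
  by (auto simp: Her_iff supp_in_def)

lemma inner_op_self:
  assumes "Her X A"
  shows "inner_op X A A = (\<Sum>i\<in>X. \<Sum>j\<in>X. (cmod (A i j))\<^sup>2)"
proof -
  have "A i j * A j i = complex_of_real ((cmod (A i j))\<^sup>2)" for i j
    unfolding Her_cnj[OF assms, of j i] complex_norm_square by simp
  then show ?thesis by (simp add: inner_op_def)
qed

lemma inner_op_self_nonneg: "Her X A \<Longrightarrow> 0 \<le> inner_op X A A"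
  by (simp add: inner_op_self sum_nonneg)

text \<open>Passes from the Hilbert-Schmidt norm to entrywise bounds, the form of boundedness that
  gives compactness in the product topology.\<close>

lemma entry_le_inner_op_self:
  assumes "finite X" "Her X A"
  shows "(cmod (A i j))\<^sup>2 \<le> inner_op X A A"
proof (cases "i \<in> X \<and> j \<in> X")
  case True
  have "(cmod (A i j))\<^sup>2 \<le> (\<Sum>j\<in>X. (cmod (A i j))\<^sup>2)"
    using True assms by (intro member_le_sum) auto
  also have "\<dots> \<le> inner_op X A A"
    unfolding inner_op_self[OF assms(2)]
    using True assms by (intro member_le_sum[of i X "\<lambda>i. \<Sum>j\<in>X. (cmod (A i j))\<^sup>2"]) (auto intro: sum_nonneg)
  finally show ?thesis .
next
  case False
  then have "A i j = 0" using assms Her_outside by blast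
  then show ?thesis using inner_op_self_nonneg[OF assms(2)] by simp
qed

lemma inner_op_self_zero:
  assumes "finite X" "Her X A" "inner_op X A A \<le> 0"
  shows "A = zero_op"
proof (intro ext)
  fix i j
  have "(cmod (A i j))\<^sup>2 \<le> 0" using entry_le_inner_op_self[OF assms(1,2)] assms(3) by (rule order_trans)
  then show "A i j = zero_op i j" by (simp add: zero_op_def)
qed

section \<open>Positive semidefinite operators: Cauchy-Schwarz and self-duality\<close>

lemma Pos_iff: "Pos X A \<longleftrightarrow> Her X A \<and> (\<forall>x. 0 \<le> Re (quad_form X A x))"
  by (simp add: Pos_def quad_form_def)

lemma Pos_imp_Her: "Pos X A \<Longrightarrow> Her X A" by (simp add: Pos_def)

lemma quad_form_add: "quad_form X (add_op A B) x = quad_form X A x + quad_form X B x"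
  by (simp add: quad_form_def add_op_def ring_distribs sum.distrib)

lemma quad_form_scale: "quad_form X (scale_op u A) x = complex_of_real u * quad_form X A x"
  by (simp add: quad_form_def scale_op_def sum_distrib_left mult_ac)

lemma quad_form_diff: "quad_form X (diff_op A B) x = quad_form X A x - quad_form X B x"
  by (simp add: quad_form_def diff_op_def ring_distribs sum_subtractf)

lemma Pos_add: "Pos X A \<Longrightarrow> Pos X B \<Longrightarrow> Pos X (add_op A B)"
  by (simp add: Pos_iff quad_form_add Her_ops)

lemma Pos_scale: "Pos X A \<Longrightarrow> 0 \<le> u \<Longrightarrow> Pos X (scale_op u A)"
  by (simp add: Pos_iff quad_form_scale Her_scale)

lemma Pos_zero [simp, intro]: "Pos X zero_op"
  by (simp add: Pos_iff quad_form_def) (simp add: zero_op_def)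

lemma quad_form_rank_one:
  "quad_form X (rank_one X v) x = complex_of_real ((cmod (\<Sum>i\<in>X. cnj (x i) * v i))\<^sup>2)"
proof -
  have "quad_form X (rank_one X v) x = (\<Sum>i\<in>X. \<Sum>j\<in>X. (cnj (x i) * v i) * cnj (cnj (x j) * v j))"
    by (simp add: quad_form_def rank_one_def mult_ac cong: sum.cong)
  also have "\<dots> = (\<Sum>i\<in>X. cnj (x i) * v i) * cnj (\<Sum>j\<in>X. cnj (x j) * v j)"
    by (simp add: sum_product)
  finally show ?thesis by (simp only: complex_norm_square)
qed

lemma Her_rank_one: "Her X (rank_one X v)"
  by (auto simp: Her_iff supp_in_def rank_one_def)

lemma Pos_rank_one: "Pos X (rank_one X v)"
  by (simp add: Pos_iff Her_rank_one quad_form_rank_one)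

lemma quad_form_unit_vector:
  assumes "finite X" "k \<in> X"
  shows "quad_form X A (\<lambda>i. if i = k then 1 else 0) = A k k"
  using assms by (simp add: quad_form_def if_distrib[of cnj] if_distribR mult_delta_left 
      if_distrib[where f="\<lambda>z. z * _"] if_distrib[where f="\<lambda>z. _ * z"] cong: if_cong)

lemma Pos_diag: "finite X \<Longrightarrow> Pos X A \<Longrightarrow> 0 \<le> Re (A k k)"
  using quad_form_unit_vector[of X k A]
  by (cases "k \<in> X") (auto simp: Pos_iff Her_iff supp_in_def dest: spec[of _ "\<lambda>i. if i = k then 1 else 0"])

lemma quad_form_shift:
  assumes "finite X" "k \<in> X" "Her X A"
  shows "quad_form X A (\<lambda>i. x i + (if i = k then s else 0)) =
    quad_form X A x + cnj s * (\<Sum>j\<in>X. A k j * x j) + s * cnj (\<Sum>j\<in>X. A k j * x j)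
      + s * cnj s * A k k"
proof -
  have e: "(\<Sum>j\<in>X. cnj (x i + (if i = k then s else 0)) * A i j * (x j + (if j = k then s else 0)))
     = (\<Sum>j\<in>X. cnj (x i) * A i j * x j) + cnj (x i) * A i k * s
       + (if i = k then cnj s * (\<Sum>j\<in>X. A k j * x j) + cnj s * A k k * s else 0)" for i
  proof -
    have "(\<Sum>j\<in>X. cnj (x i + (if i = k then s else 0)) * A i j * (x j + (if j = k then s else 0)))
      = (\<Sum>j\<in>X. cnj (x i + (if i = k then s else 0)) * A i j * x j) + 
        (\<Sum>j\<in>X. if j = k then cnj (x i + (if i = k then s else 0)) * A i k * s else 0)"
      unfolding sum.distrib[symmetric] by (rule sum.cong) (auto simp: ring_distribs)
    also have "\<dots> = (\<Sum>j\<in>X. cnj (x i + (if i = k then s else 0)) * A i j * x j)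
       + cnj (x i + (if i = k then s else 0)) * A i k * s"
      using assms by simp
    finally show ?thesis
      by (auto simp: ring_distribs sum.distrib sum_distrib_left mult_ac)
  qed
  have c: "cnj (\<Sum>j\<in>X. A k j * x j) = (\<Sum>i\<in>X. cnj (x i) * A i k)"
    using assms(3) by (simp add: Her_iff mult.commute)
  show ?thesis unfolding c
    unfolding quad_form_def e using assms
    by (simp add: sum.distrib sum_distrib_left sum_distrib_right mult_ac)
qed

text \<open>Cauchy-Schwarz for the semi-inner product of \<open>A\<close>, with a basis vector as
  one argument: the form is nonnegative along a line through \<open>x\<close> in direction
  \<open>k\<close>.\<close>

lemma Pos_Cauchy_Schwarz:
  assumes "finite X" "Pos X A" "k \<in> X"
  shows "(cmod (\<Sum>j\<in>X. A k j * x j))\<^sup>2 \<le> Re (A k k) * Re (quad_form X A x)"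
proof -
  define u where "u = (\<Sum>j\<in>X. A k j * x j)"
  define a where "a = Re (A k k)"
  define Q where "Q = Re (quad_form X A x)"
  have her: "Her X A" using assms(2) by (rule Pos_imp_Her)
  have a0: "0 \<le> a" unfolding a_def using assms by (simp add: Pos_diag)
  have Q0: "0 \<le> Q" unfolding Q_def using assms(2) by (simp add: Pos_iff)
  have main: "0 \<le> Q - 2 * t * (cmod u)\<^sup>2 + t\<^sup>2 * (cmod u)\<^sup>2 * a" for t :: real
  proof -
    \<comment> \<open>The factor \<open>u\<close> aligns the phases, so that both cross terms become
      real and equal.\<close>
    define s where "s = - complex_of_real t * u"
    have s1: "Re (cnj s * u) = - t * (cmod u)\<^sup>2" "Re (s * cnj u) = - t * (cmod u)\<^sup>2"
      by (simp_all add: s_def cmod_power2) (simp_all add: power2_eq_square algebra_simps)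
    have "s * cnj s = complex_of_real (t\<^sup>2 * (cmod u)\<^sup>2)"
      by (simp only: complex_norm_square[symmetric]) (simp add: s_def norm_mult power_mult_distrib)
    then have s2: "Re (s * cnj s * A k k) = t\<^sup>2 * (cmod u)\<^sup>2 * a"
      by (simp add: a_def)
    have "0 \<le> Re (quad_form X A (\<lambda>i. x i + (if i = k then s else 0)))"
      using assms(2) by (simp add: Pos_iff)
    also have "\<dots> = Q + Re (cnj s * u) + Re (s * cnj u) + Re (s * cnj s * A k k)"
      unfolding quad_form_shift[OF assms(1,3) her] Q_def u_def by simp
    finally show ?thesis unfolding s1 s2 by simp
  qed
  have "(cmod u)\<^sup>2 \<le> a * Q"
  proof (cases "a = 0")
    case True
    have "u = 0"
    proof (rule ccontr)
      assume "u \<noteq> 0"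
      then have "(cmod u)\<^sup>2 > 0" by simp
      \<comment> \<open>For \<open>a = 0\<close> the bound is affine in \<open>t\<close>; this
        \<open>t\<close> makes it -1.\<close>
      with main[of "(Q + 1) / (2 * (cmod u)\<^sup>2)"] True show False by (simp add: field_simps)
    qed
    then show ?thesis using True by simp
  next
    case False
    then have "a > 0" using a0 by simp
    then show ?thesis using main[of "1 / a"] by (simp add: field_simps power2_eq_square)
  qed
  then show ?thesis by (simp add: u_def a_def Q_def)
qed

lemma Pos_entry_le_diag:
  assumes "finite X" "Pos X A"
  shows "(cmod (A i j))\<^sup>2 \<le> Re (A i i) * Re (A j j)"
proof (cases "i \<in> X \<and> j \<in> X")
  case True
  have "(\<Sum>l\<in>X. A i l * (if l = j then 1 else 0)) = A i j"
    using True assms(1) by (simp add: if_distrib[where f="\<lambda>z. _ * z"] cong: if_cong)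
  then show ?thesis
    using Pos_Cauchy_Schwarz[OF assms, of i "\<lambda>l. if l = j then 1 else 0"] True
      quad_form_unit_vector[OF assms(1), of j A] by simp
next
  case False
  then have "A i j = 0" using Her_outside[OF Pos_imp_Her[OF assms(2)]] by blast
  then show ?thesis using Pos_diag[OF assms] by simp
qed

lemma Pos_diag_le_trace:
  assumes "finite X" "Pos X A"
  shows "Re (A i i) \<le> trace_re X A"
proof (cases "i \<in> X")
  case True
  then show ?thesis unfolding trace_re_def
    using assms Pos_diag by (intro member_le_sum) auto
next
  case False
  then have "A i i = 0" using Her_outside[OF Pos_imp_Her[OF assms(2)]] by blast
  then show ?thesis using Pos_diag[OF assms] by (simp add: trace_re_def sum_nonneg)
qed

lemma Pos_entry_le_trace:
  assumes "finite X" "Pos X A"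
  shows "cmod (A i j) \<le> trace_re X A"
proof -
  have t0: "0 \<le> trace_re X A" using assms Pos_diag by (auto simp: trace_re_def intro!: sum_nonneg)
  have "(cmod (A i j))\<^sup>2 \<le> trace_re X A * trace_re X A"
    using Pos_entry_le_diag[OF assms, of i j] Pos_diag_le_trace[OF assms] Pos_diag[OF assms]
    by (meson mult_mono order_trans t0)
  then show ?thesis using t0 by (metis power2_eq_square power2_le_imp_le)
qed

text \<open>Nonnegativity of the difference is exactly \<open>Pos_Cauchy_Schwarz\<close> for row
  \<open>k\<close>, divided by the pivot.\<close>

lemma Pos_schur_complement:
  assumes "finite X" "Pos X P" "k \<in> X" "P k k \<noteq> 0"
  shows "Pos X (diff_op P (scale_op (1 / Re (P k k)) (rank_one X (\<lambda>i. P i k))))"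
    (is "Pos X (diff_op P (scale_op _ ?R))")
proof -
  have her: "Her X P" using assms(2) by (rule Pos_imp_Her)
  have "Im (P k k) = 0" using Her_cnj[OF her, of k k] by (simp add: complex_eq_iff)
  then have pk: "Re (P k k) > 0" using assms(4) Pos_diag[OF assms(1,2), of k]
    by (simp add: complex_eq_iff)
  have "0 \<le> Re (quad_form X P x) - 1 / Re (P k k) * Re (quad_form X ?R x)" for x
  proof -
    have "(\<Sum>i\<in>X. cnj (x i) * P i k) = cnj (\<Sum>j\<in>X. P k j * x j)"
      using her by (simp add: Her_iff mult.commute)
    then have "Re (quad_form X ?R x) = (cmod (\<Sum>j\<in>X. P k j * x j))\<^sup>2"
      by (simp only: quad_form_rank_one complex_mod_cnj Re_complex_of_real)
    also have "\<dots> \<le> Re (P k k) * Re (quad_form X P x)"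
      using Pos_Cauchy_Schwarz assms by blast
    finally show ?thesis using pk by (simp add: field_simps)
  qed
  then show ?thesis
    by (auto simp: Pos_iff quad_form_diff quad_form_scale intro!: Her_ops Her_scale her Her_rank_one)
qed

text \<open>Peeling off one rank-one Schur complement per basis vector (Cholesky).\<close>

lemma inner_op_Pos_nonneg:
  assumes "finite X" "Pos X P" "Pos X Q"
  shows "0 \<le> inner_op X P Q"
proof -
  \<comment> \<open>The induction is on a set \<open>Y\<close> containing all nonzero rows of
    \<open>P\<close>, while the ambient index set \<open>X\<close> stays fixed.\<close>
  have "0 \<le> inner_op X P Q" if "finite Y" "Y \<subseteq> X" "Pos X P" "\<And>i j. i \<notin> Y \<Longrightarrow> P i j = 0" for Y P
    using that
  proof (induction Y arbitrary: P rule: finite_induct)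
    case empty
    then show ?case by (simp add: inner_op_def)
  next
    case (insert k Y)
    have k: "k \<in> X" using insert by simp
    show ?case
    proof (cases "P k k = 0")
      case True
      have "P k j = 0" for j using Pos_entry_le_diag[OF assms(1) insert.prems(2), of k j] True by simp
      then show ?thesis using insert.IH[of P] insert.prems by (metis insertE insert_subset)
    next
      case False
      define c where "c = 1 / Re (P k k)"
      define R where "R = rank_one X (\<lambda>i. P i k)"
      define P' where "P' = diff_op P (scale_op c R)"
      have her: "Her X P" using insert.prems(2) by (rule Pos_imp_Her)
      have re: "P k k = complex_of_real (Re (P k k))"
        using Her_cnj[OF her, of k k] by (simp add: complex_eq_iff)
      have "c \<ge> 0" unfolding c_def using Pos_diag[OF assms(1) insert.prems(2), of k] by simp
      have P': "Pos X P'"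
        unfolding P'_def c_def R_def
        using Pos_schur_complement[OF assms(1) insert.prems(2) k False] .
      \<comment> \<open>The subtraction clears row \<open>k\<close>. It creates nothing in the other
        rows outside \<open>Y\<close>, since column \<open>k\<close> of \<open>P\<close> already
        vanishes there.\<close>
      have "P' i j = 0" if "i \<notin> Y" for i j
      proof (cases "i = k")
        case True
        show ?thesis
        proof (cases "j \<in> X")
          case True
          have "P' k j = P k j - complex_of_real (1 / Re (P k k)) * (P k k * cnj (P j k))"
            using True k by (simp add: P'_def R_def c_def rank_one_def op_defs)
          also have "\<dots> = 0" 
            using re False Her_cnj[OF her, of j k] by (metis (no_types, lifting) complex_cnj_cnj divide_self_if eq_iff_diff_eq_0 mult.assoc mult_1 nonzero_eq_divide_eq of_real_1 of_real_divide)
          finally show ?thesis using \<open>i = k\<close> by simp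
        next
          case False
          then show ?thesis using Her_outside[OF Pos_imp_Her[OF P']] by blast
        qed
      next
        case False
        then have "P i j = 0" "P i k = 0" using insert.prems(3) that by auto
        then show ?thesis by (simp add: P'_def R_def rank_one_def op_defs)
      qed
      then have "0 \<le> inner_op X P' Q" using insert.IH[of P'] P' insert.prems(1) by blast
      moreover have "0 \<le> inner_op X R Q"
        unfolding R_def inner_op_commute[of X _ Q] inner_op_rank_one using assms(3) by (simp add: Pos_iff)
      moreover have "inner_op X P' Q = inner_op X P Q - c * inner_op X R Q"
        by (simp add: P'_def inner_op_linear)
      ultimately show ?thesis using \<open>c \<ge> 0\<close> by (metis diff_ge_0_iff_ge mult_nonneg_nonneg order_trans)
    qed
  qed
  from this[of X P] assms show ?thesis by (auto simp: Pos_iff Her_iff supp_in_def)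
qed

lemma Pos_if_inner_nonneg:
  assumes "Her X A" "\<And>P. Pos X P \<Longrightarrow> 0 \<le> inner_op X A P"
  shows "Pos X A"
  using assms by (metis Pos_iff Pos_rank_one inner_op_rank_one)

lemma quad_form_id_op: "finite X \<Longrightarrow> quad_form X (id_op X) x = complex_of_real (\<Sum>i\<in>X. (cmod (x i))\<^sup>2)"
proof -
  assume "finite X"
  then have "quad_form X (id_op X) x = (\<Sum>i\<in>X. \<Sum>j\<in>X. if j = i then cnj (x i) * x i else 0)"
    unfolding quad_form_def id_op_def by (intro sum.cong refl) auto
  also have "\<dots> = (\<Sum>i\<in>X. cnj (x i) * x i)" using \<open>finite X\<close> by simp
  finally show ?thesis unfolding of_real_sum complex_norm_square by (simp add: mult.commute)
qed

text \<open>The sum of all entry moduli bounds the quadratic form of \<open>A\<close> on unit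
  vectors. Stating it for every larger \<open>k\<close> lets several thresholds be met at once in
  \<open>combs_Her_plus_flat_comb\<close>.\<close>

lemma Her_plus_multiple_id_Pos:
  assumes "finite X" "Her X A"
  shows "\<exists>k0. \<forall>k\<ge>k0. Pos X (add_op A (scale_op k (id_op X)))"
proof (intro exI allI impI)
  define B where "B = (\<Sum>i\<in>X. \<Sum>j\<in>X. cmod (A i j))"
  fix k assume k: "B \<le> k"
  have "0 \<le> Re (quad_form X (add_op A (scale_op k (id_op X))) x)" for x
  proof -
    define N where "N = (\<Sum>i\<in>X. (cmod (x i))\<^sup>2)"
    have N: "cmod (x i) * cmod (x j) \<le> N" if "i \<in> X" "j \<in> X" for i j
    proof -
      have "(cmod (x i))\<^sup>2 \<le> N" "(cmod (x j))\<^sup>2 \<le> N"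
        unfolding N_def using that assms(1) by (auto intro: member_le_sum)
      moreover have "2 * (cmod (x i) * cmod (x j)) \<le> (cmod (x i))\<^sup>2 + (cmod (x j))\<^sup>2"
        using sum_squares_bound[of "cmod (x i)" "cmod (x j)"] by simp
      ultimately show ?thesis by linarith
    qed
    have "cmod (quad_form X A x) \<le> (\<Sum>i\<in>X. \<Sum>j\<in>X. cmod (cnj (x i) * A i j * x j))"
      unfolding quad_form_def by (intro order_trans[OF norm_sum] sum_mono norm_sum)
    also have "\<dots> \<le> (\<Sum>i\<in>X. \<Sum>j\<in>X. cmod (A i j) * N)"
    proof (intro sum_mono)
      fix i j assume ij: "i \<in> X" "j \<in> X"
      have "cmod (cnj (x i) * A i j * x j) = cmod (A i j) * (cmod (x i) * cmod (x j))"
        by (simp add: norm_mult)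
      also have "\<dots> \<le> cmod (A i j) * N" using N[OF ij] by (intro mult_left_mono) auto
      finally show "cmod (cnj (x i) * A i j * x j) \<le> cmod (A i j) * N" .
    qed
    also have "\<dots> = B * N" by (simp add: B_def sum_distrib_right)
    also have "\<dots> \<le> k * N" using k by (intro mult_right_mono) (auto simp: N_def sum_nonneg)
    finally have "- Re (quad_form X A x) \<le> k * N"
      using abs_Re_le_cmod[of "quad_form X A x"] by linarith
    then show ?thesis
      by (simp add: quad_form_add quad_form_scale quad_form_id_op[OF assms(1)] flip: N_def)
  qed
  moreover have "Her X (id_op X)" by (auto simp: Her_iff supp_in_def id_op_def)
  ultimately show "Pos X (add_op A (scale_op k (id_op X)))"
    using assms(2) by (auto simp: Pos_iff intro!: Her_ops Her_scale)
qed

lemma trace_re_linear: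
  "trace_re X (add_op A B) = trace_re X A + trace_re X B"
  "trace_re X (diff_op A B) = trace_re X A - trace_re X B"
  "trace_re X (scale_op u A) = u * trace_re X A"
  by (simp_all add: trace_re_def op_defs sum.distrib sum_subtractf sum_distrib_left)

section \<open>Combs and their duals\<close>

text \<open>Prepends a single tensor factor. The index sets of both kinds arise by iterating it, so
  tensoring and partial traces are studied one factor at a time.\<close>

definition cset :: "nat \<Rightarrow> nat list set \<Rightarrow> nat list set" where
  "cset n X = {w # r | w r. w < n \<and> r \<in> X}"

lemma cset_Nil [simp]: "[] \<notin> cset n X"
  and cset_Cons [simp]: "w # r \<in> cset n X \<longleftrightarrow> w < n \<and> r \<in> X"
  by (auto simp: cset_def)

lemma cset_eq: "cset n X = (\<lambda>(w, r). w # r) ` ({..<n} \<times> X)"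
  by (auto simp: cset_def)

lemma finite_cset: "finite X \<Longrightarrow> finite (cset n X)"
  by (simp add: cset_eq)

lemma sum_cset: "(\<Sum>i\<in>cset n X. f i) = (\<Sum>w<n. \<Sum>r\<in>X. f (w # r))"
proof -
  have "inj_on (\<lambda>(w, r). w # r) ({..<n} \<times> X)" by (auto simp: inj_on_def)
  then show ?thesis
    by (simp add: cset_eq sum.reindex sum.cartesian_product split_def)
qed

lemma idxWV_Suc: "idxWV nV nW (Suc t) = cset (nW (Suc t)) (cset (nV (Suc t)) (idxWV nV nW t))"
  by (auto simp: cset_def)

lemma idxV_Suc: "idxV nV nW (Suc t) = cset (nV (Suc t)) (idxWV nV nW t)"
  by (auto simp: cset_def idxV_def)

lemma finite_idxWV: "finite (idxWV nV nW t)"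
  by (induction t) (simp_all only: idxWV_Suc finite_cset, simp)

section \<open>Tensoring with the identity and the partial trace\<close>

lemma id_tensor_Cons [simp]:
  "id_tensor n A (w # r) (w' # r') = (if w = w' \<and> w < n then A r r' else 0)"
  and id_tensor_Nil [simp]: "id_tensor n A [] j = 0" "id_tensor n A i [] = 0"
  by (auto simp: id_tensor_def split: list.splits)

lemma id_tensor_eqI:
  assumes "\<And>j. B [] j = 0" "\<And>i. B i [] = 0"
    and "\<And>w r w' r'. B (w # r) (w' # r') = (if w = w' \<and> w < n then A r r' else 0)"
  shows "B = id_tensor n A"
proof (intro ext)
  fix i j show "B i j = id_tensor n A i j" using assms by (cases i; cases j) auto
qed

lemma id_tensor_linear:
  "id_tensor n (add_op A B) = add_op (id_tensor n A) (id_tensor n B)"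
  "id_tensor n (scale_op u A) = scale_op u (id_tensor n A)"
  "id_tensor n zero_op = zero_op"
  by (rule id_tensor_eqI[symmetric]; simp add: op_defs)+

lemma ptrace_linear:
  "ptrace n (add_op A B) = add_op (ptrace n A) (ptrace n B)"
  "ptrace n (diff_op A B) = diff_op (ptrace n A) (ptrace n B)"
  "ptrace n (scale_op u A) = scale_op u (ptrace n A)"
  by (auto simp: ptrace_def op_defs sum.distrib sum_subtractf sum_distrib_left fun_eq_iff)

lemma ptrace_id_tensor: "ptrace n (id_tensor n A) = scale_op (real n) A"
  by (auto simp: ptrace_def scale_op_def fun_eq_iff)

lemma Her_id_tensor: "Her X A \<Longrightarrow> Her (cset n X) (id_tensor n A)"
  unfolding Her_iff supp_in_def
  by (intro conjI allI; rename_tac i j; case_tac i; case_tac j) auto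

lemma Her_ptrace: "Her (cset n X) A \<Longrightarrow> Her X (ptrace n A)"
  by (auto simp: Her_iff supp_in_def ptrace_def)

text \<open>Adjointness of tensoring and partial trace; every pairing descends one factor through
  it.\<close>

lemma inner_op_id_tensor:
  "inner_op (cset n X) (id_tensor n A) B = inner_op X A (ptrace n B)"
proof -
  have "(\<Sum>i\<in>cset n X. \<Sum>j\<in>cset n X. id_tensor n A i j * B j i) =
    (\<Sum>w<n. \<Sum>r\<in>X. \<Sum>r'\<in>X. A r r' * B (w # r') (w # r))"
    unfolding sum_cset
  proof (intro sum.cong refl)
    fix w r assume w: "w \<in> {..<n}"
    have "(\<Sum>w'<n. \<Sum>r'\<in>X. id_tensor n A (w # r) (w' # r') * B (w' # r') (w # r))
      = (\<Sum>w'<n. if w' = w then \<Sum>r'\<in>X. A r r' * B (w # r') (w # r) else 0)"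
      using w by (intro sum.cong) auto
    then show "(\<Sum>w'<n. \<Sum>r'\<in>X. id_tensor n A (w # r) (w' # r') * B (w' # r') (w # r))
      = (\<Sum>r'\<in>X. A r r' * B (w # r') (w # r))" using w by simp
  qed
  also have "\<dots> = (\<Sum>r\<in>X. \<Sum>w<n. \<Sum>r'\<in>X. A r r' * B (w # r') (w # r))"
    by (rule sum.swap)
  also have "\<dots> = (\<Sum>r\<in>X. \<Sum>r'\<in>X. \<Sum>w<n. A r r' * B (w # r') (w # r))"
    by (rule sum.cong[OF refl], rule sum.swap)
  finally show ?thesis by (simp add: inner_op_def ptrace_def sum_distrib_left)
qed

lemma quad_form_id_tensor:
  "quad_form (cset n X) (id_tensor n A) x = (\<Sum>w<n. quad_form X A (\<lambda>r. x (w # r)))"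
  unfolding sum_cset quad_form_def
proof (intro sum.cong refl)
  fix w r assume w: "w \<in> {..<n}"
  have "(\<Sum>w'<n. \<Sum>r'\<in>X. cnj (x (w # r)) * id_tensor n A (w # r) (w' # r') * x (w' # r'))
    = (\<Sum>w'<n. if w' = w then \<Sum>r'\<in>X. cnj (x (w # r)) * A r r' * x (w # r') else 0)"
    using w by (intro sum.cong) auto
  then show "(\<Sum>w'<n. \<Sum>r'\<in>X. cnj (x (w # r)) * id_tensor n A (w # r) (w' # r') * x (w' # r'))
    = (\<Sum>r'\<in>X. cnj (x (w # r)) * A r r' * x (w # r'))" using w by simp
qed

lemma Pos_id_tensor: "Pos X A \<Longrightarrow> Pos (cset n X) (id_tensor n A)"
  by (auto simp: Pos_iff Her_id_tensor quad_form_id_tensor intro!: sum_nonneg)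

lemma Pos_ptrace:
  assumes "finite X" "Pos (cset n X) A"
  shows "Pos X (ptrace n A)"
proof (rule Pos_if_inner_nonneg)
  show "Her X (ptrace n A)" using assms by (simp add: Her_ptrace Pos_imp_Her)
  fix P assume "Pos X P"
  then have "0 \<le> inner_op (cset n X) (id_tensor n P) A"
    using assms by (intro inner_op_Pos_nonneg finite_cset Pos_id_tensor)
  then show "0 \<le> inner_op X (ptrace n A) P"
    by (simp add: inner_op_id_tensor inner_op_commute[of X P])
qed

lemma trace_re_ptrace: "trace_re (cset n X) A = trace_re X (ptrace n A)"
  unfolding trace_re_def sum_cset ptrace_def Re_sum by (rule sum.swap)

lemma trace_re_id_tensor: "trace_re (cset n X) (id_tensor n A) = n * trace_re X A"
  by (simp add: trace_re_ptrace ptrace_id_tensor trace_re_linear)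

text \<open>\<open>G\<close> is \<open>H\<close> minus its projection onto the operators of the form
  identity tensor something. It has zero partial trace, so it is orthogonal both to \<open>H\<close>
  by hypothesis and to the projection by adjointness, hence to itself.\<close>

lemma id_tensor_if_orthogonal:
  assumes "finite X" "0 < n" "Her (cset n X) H"
    and "\<And>Y. Her (cset n X) Y \<Longrightarrow> ptrace n Y = zero_op \<Longrightarrow> inner_op (cset n X) H Y = 0"
  shows "H = id_tensor n (scale_op (1 / n) (ptrace n H))"
proof -
  define \<tau> where "\<tau> = scale_op (1 / n) (ptrace n H)"
  define G where "G = diff_op H (id_tensor n \<tau>)"
  have G: "Her (cset n X) G"
    unfolding G_def \<tau>_def using assms(3) by (intro Her_ops Her_id_tensor Her_scale Her_ptrace)
  have pG: "ptrace n G = zero_op"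
    using assms(2) by (simp add: G_def \<tau>_def ptrace_linear ptrace_id_tensor) (simp add: op_defs)
  have "inner_op (cset n X) H G = 0" using assms(4) G pG by blast
  moreover have "inner_op (cset n X) (id_tensor n \<tau>) G = 0" by (simp add: inner_op_id_tensor pG)
  ultimately have "inner_op (cset n X) G G = 0"
    by (subst (1) G_def) (simp add: inner_op_linear)
  then have "G = zero_op" using inner_op_self_zero[OF finite_cset[OF assms(1)] G] by simp
  then show ?thesis by (auto simp: G_def \<tau>_def op_defs fun_eq_iff)
qed

text \<open>With \<open>Q = Pos\<close> and \<open>s = 1\<close> these are the combs; with \<open>Q = Her\<close> they form the affine
  hyperplane \<open>s\<close> of the linear span of the combs.\<close>

fun combs :: "(nat list set \<Rightarrow> op \<Rightarrow> bool) \<Rightarrow> (nat \<Rightarrow> nat) \<Rightarrow> (nat \<Rightarrow> nat) \<Rightarrow> nat \<Rightarrow> real \<Rightarrow> op set" where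
  "combs Q nV nW 0 s = {scale_op s unit_op}"
| "combs Q nV nW (Suc t) s = {X. Q (idxWV nV nW (Suc t)) X \<and>
     (\<exists>Y\<in>combs Q nV nW t s. ptrace (nW (Suc t)) X = id_tensor (nV (Suc t)) Y)}"

text \<open>Level 1 is \<open>SG\<close>. Other positive levels are its multiples, which are needed
  because the residual in \<open>dominating_comb\<close> comes without a normalisation.\<close>

fun cochains :: "(nat \<Rightarrow> nat) \<Rightarrow> (nat \<Rightarrow> nat) \<Rightarrow> nat \<Rightarrow> real \<Rightarrow> op set" where
  "cochains nV nW 0 s = {scale_op s unit_op}"
| "cochains nV nW (Suc t) s = {id_tensor (nW (Suc t)) \<tau> | \<tau>.
     Pos (idxV nV nW (Suc t)) \<tau> \<and> ptrace (nV (Suc t)) \<tau> \<in> cochains nV nW t s}"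

section \<open>Levels of combs and cochains\<close>

lemma scale_op_one [simp]: "scale_op 1 A = A" by (simp add: scale_op_def)

lemma scale_op_scale_op [simp]: "scale_op u (scale_op v A) = scale_op (u * v) A"
  by (simp add: scale_op_def mult.assoc)

lemma scale_op_zero [simp]: "scale_op 0 A = zero_op" "scale_op u zero_op = zero_op"
  by (simp_all add: op_defs)

lemma Pos_unit_op: "Pos (idxWV nV nW 0) unit_op"
  by (simp add: Pos_iff Her_iff supp_in_def unit_op_def quad_form_def)

lemma combs_Pos_Her: "X \<in> combs Pos nV nW t s \<Longrightarrow> X \<in> combs Her nV nW t s"
  by (induction t arbitrary: X) (auto intro: Pos_imp_Her)

lemma combs_Her: "X \<in> combs Her nV nW t s \<Longrightarrow> Her (idxWV nV nW t) X"
  using Pos_imp_Her[OF Pos_unit_op] by (cases t) (auto intro: Her_scale simp del: idxWV.simps(1))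

lemma cochains_Pos:
  assumes "\<phi> \<in> cochains nV nW t s" "0 \<le> s"
  shows "Pos (idxWV nV nW t) \<phi>"
proof (cases t)
  case 0
  then show ?thesis using assms Pos_scale[OF Pos_unit_op] by simp
next
  case (Suc t')
  then show ?thesis using assms by (auto simp only: cochains.simps idxV_Suc idxWV_Suc intro!: Pos_id_tensor)
qed

text \<open>Adjointness strips the output factor from the cochain, where the comb condition applies,
  and then the input factor from the comb, where the cochain condition applies. The levels multiply
  on the trivial system.\<close>

lemma inner_op_cochains_combs:
  "\<phi> \<in> cochains nV nW t s \<Longrightarrow> X \<in> combs Her nV nW t u \<Longrightarrow> inner_op (idxWV nV nW t) \<phi> X = s * u"
proof (induction t arbitrary: \<phi> X)
  case 0
  then show ?case by (simp add: inner_op_def op_defs unit_op_def)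
next
  case (Suc t)
  then obtain \<tau> Y where *: "\<phi> = id_tensor (nW (Suc t)) \<tau>" "ptrace (nV (Suc t)) \<tau> \<in> cochains nV nW t s"
    "Y \<in> combs Her nV nW t u" "ptrace (nW (Suc t)) X = id_tensor (nV (Suc t)) Y"
    by auto
  have "inner_op (idxWV nV nW (Suc t)) \<phi> X = inner_op (idxWV nV nW t) Y (ptrace (nV (Suc t)) \<tau>)"
    unfolding idxWV_Suc *(1) inner_op_id_tensor *(4) inner_op_commute[of _ \<tau>] ..
  then show ?case using Suc.IH[OF *(2,3)] by (simp add: inner_op_commute)
qed

lemma cochains_scale:
  "\<phi> \<in> cochains nV nW t s \<Longrightarrow> 0 \<le> u \<Longrightarrow> scale_op u \<phi> \<in> cochains nV nW t (u * s)"
proof (induction t arbitrary: \<phi>)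
  case 0 then show ?case by simp
next
  case (Suc t)
  then obtain \<tau> where *: "\<phi> = id_tensor (nW (Suc t)) \<tau>" "Pos (idxV nV nW (Suc t)) \<tau>"
    "ptrace (nV (Suc t)) \<tau> \<in> cochains nV nW t s" by auto
  show ?case
    using *(2,3) Suc.IH Suc.prems(2)
    by (auto simp: *(1) ptrace_linear Pos_scale simp flip: id_tensor_linear(2) intro!: exI[of _ "scale_op u \<tau>"])
qed

lemma combs_lincomb:
  "X \<in> combs Her nV nW t s \<Longrightarrow> Y \<in> combs Her nV nW t s' \<Longrightarrow>
   add_op (scale_op u X) (scale_op v Y) \<in> combs Her nV nW t (u * s + v * s')"
proof (induction t arbitrary: X Y)
  case 0 then show ?case by (auto simp: op_defs unit_op_def fun_eq_iff)
next
  case (Suc t)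
  then obtain X' Y' where *: "X' \<in> combs Her nV nW t s" "ptrace (nW (Suc t)) X = id_tensor (nV (Suc t)) X'"
     "Y' \<in> combs Her nV nW t s'" "ptrace (nW (Suc t)) Y = id_tensor (nV (Suc t)) Y'"
     "Her (idxWV nV nW (Suc t)) X" "Her (idxWV nV nW (Suc t)) Y" by auto
  have "ptrace (nW (Suc t)) (add_op (scale_op u X) (scale_op v Y)) =
     id_tensor (nV (Suc t)) (add_op (scale_op u X') (scale_op v Y'))"
    by (simp add: ptrace_linear id_tensor_linear *)
  then show ?case using Suc.IH[OF *(1,3)] *(5,6) by (auto intro!: Her_ops Her_scale simp del: idxWV.simps)
qed

text \<open>The comb that ignores its inputs and emits maximally mixed states. As a positive
  multiple of the identity it serves as an interior point among the combs.\<close>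

fun flat_comb :: "(nat \<Rightarrow> nat) \<Rightarrow> (nat \<Rightarrow> nat) \<Rightarrow> nat \<Rightarrow> op" where
  "flat_comb nV nW 0 = unit_op"
| "flat_comb nV nW (Suc t) =
     scale_op (1 / nW (Suc t)) (id_tensor (nW (Suc t)) (id_tensor (nV (Suc t)) (flat_comb nV nW t)))"

lemma id_tensor_id_op: "id_tensor n (id_op X) = id_op (cset n X)"
  by (rule id_tensor_eqI[symmetric]) (auto simp: id_op_def)

lemma flat_comb_eq:
  assumes "\<forall>t'\<in>{1..t}. 0 < nW t'"
  shows "\<exists>k>0. flat_comb nV nW t = scale_op k (id_op (idxWV nV nW t))"
  using assms
proof (induction t)
  case 0
  have "unit_op = id_op {[]}" by (auto simp: unit_op_def id_op_def fun_eq_iff)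
  then show ?case by (intro exI[of _ 1]) simp
next
  case (Suc t)
  then obtain k where k: "k > 0" "flat_comb nV nW t = scale_op k (id_op (idxWV nV nW t))" by auto
  have "0 < nW (Suc t)" using Suc.prems by simp
  then show ?case using k
    by (intro exI[of _ "1 / nW (Suc t) * k"])
       (simp add: k idxWV_Suc id_tensor_linear id_tensor_id_op del: idxWV.simps)
qed

lemma ptrace_flat_comb:
  "0 < nW (Suc t) \<Longrightarrow> ptrace (nW (Suc t)) (flat_comb nV nW (Suc t)) = id_tensor (nV (Suc t)) (flat_comb nV nW t)"
  by (simp add: ptrace_linear ptrace_id_tensor)

lemma flat_comb_chain:
  assumes "\<forall>t'\<in>{1..t}. 0 < nW t'"
  shows "flat_comb nV nW t \<in> combs Pos nV nW t 1"
  using assms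
proof (induction t)
  case 0 then show ?case by simp
next
  case (Suc t)
  have "Pos (idxWV nV nW t) (flat_comb nV nW t)" for t
    by (induction t) (auto simp only: flat_comb.simps idxWV_Suc intro!: Pos_scale Pos_id_tensor Pos_unit_op, simp)
  then show ?case using Suc ptrace_flat_comb[of nW t nV] by (auto simp del: idxWV.simps flat_comb.simps)
qed

lemma combs_Her_plus_flat_comb:
  assumes "\<forall>t'\<in>{1..t}. 0 < nW t'" "X \<in> combs Her nV nW t s"
  shows "\<exists>k0. \<forall>k\<ge>k0. add_op X (scale_op k (flat_comb nV nW t)) \<in> combs Pos nV nW t (s + k)"
  using assms
proof (induction t arbitrary: X)
  case 0 then show ?case by (auto simp: op_defs fun_eq_iff ring_distribs)
next
  case (Suc t)
  then obtain Y where *: "Y \<in> combs Her nV nW t s" "ptrace (nW (Suc t)) X = id_tensor (nV (Suc t)) Y"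
     "Her (idxWV nV nW (Suc t)) X" by auto
  obtain k1 where k1: "\<forall>k\<ge>k1. add_op Y (scale_op k (flat_comb nV nW t)) \<in> combs Pos nV nW t (s + k)"
    using Suc.IH[OF _ *(1)] Suc.prems by auto
  obtain \<kappa> where \<kappa>: "\<kappa> > 0" "flat_comb nV nW (Suc t) = scale_op \<kappa> (id_op (idxWV nV nW (Suc t)))"
    using flat_comb_eq[OF Suc.prems(1)] by blast
  obtain k2 where k2: "\<forall>k\<ge>k2. Pos (idxWV nV nW (Suc t)) (add_op X (scale_op k (id_op (idxWV nV nW (Suc t)))))"
    using Her_plus_multiple_id_Pos[OF finite_idxWV *(3)] by blast
  \<comment> \<open>At this level the flat comb is \<open>\<kappa>\<close> times the identity,
    whence \<open>k2 / \<kappa>\<close>; \<open>k1\<close> serves the level below.\<close>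
  have "add_op X (scale_op k (flat_comb nV nW (Suc t))) \<in> combs Pos nV nW (Suc t) (s + k)"
    if "k \<ge> max k1 (k2 / \<kappa>)" for k
  proof -
    have "k \<ge> k1" "k * \<kappa> \<ge> k2" using that \<kappa>(1) by (auto simp: field_simps)
    then have "Pos (idxWV nV nW (Suc t)) (add_op X (scale_op k (flat_comb nV nW (Suc t))))"
      using k2 unfolding \<kappa>(2) scale_op_scale_op by blast
    moreover have "0 < nW (Suc t)" using Suc.prems by simp
    then have "ptrace (nW (Suc t)) (add_op X (scale_op k (flat_comb nV nW (Suc t)))) =
        id_tensor (nV (Suc t)) (add_op Y (scale_op k (flat_comb nV nW t)))"
      by (simp only: ptrace_linear ptrace_flat_comb id_tensor_linear *(2))
    ultimately show ?thesis
      using k1 \<open>k \<ge> k1\<close> by (auto simp del: idxWV.simps flat_comb.simps)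
  qed
  then show ?case by blast
qed

lemma lin_span_lincomb2:
  assumes "x \<in> A" "y \<in> A"
  shows "add_op (scale_op u x) (scale_op v y) \<in> lin_span A"
\<comment> \<open>Coefficients in \<open>lin_span\<close> are a function on a set of operators, so
  coinciding operators must have their coefficients merged.\<close>
proof (cases "x = y")
  case True
  then show ?thesis unfolding lin_span_def using assms
    by (auto intro!: exI[of _ "{x}"] exI[of _ "\<lambda>_. u + v"] simp: op_defs ring_distribs)
next
  case False
  then show ?thesis unfolding lin_span_def using assms
    by (auto intro!: exI[of _ "{x, y}"] exI[of _ "\<lambda>z. if z = x then u else v"] simp: op_defs)
qed

lemma Chn_eq_combs: "Chn T nV nW = combs Pos nV nW T 1"
proof -
  have "(\<exists>cs :: nat \<Rightarrow> op. cs T = c \<and> cs 0 = unit_op \<and>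
      (\<forall>t\<in>{1..T}. Pos (idxWV nV nW t) (cs t) \<and>
                   ptrace (nW t) (cs t) = id_tensor (nV t) (cs (t - 1)))) \<longleftrightarrow> c \<in> combs Pos nV nW T 1"
      (is "?L T c \<longleftrightarrow> _") for c
  proof (induction T arbitrary: c)
    case 0
    show ?case by (auto intro: exI[of _ "\<lambda>_. unit_op"])
  next
    case (Suc T)
    show ?case
    proof
      assume "?L (Suc T) c"
      then obtain cs where cs: "cs (Suc T) = c" "cs 0 = unit_op" "\<forall>t\<in>{1..Suc T}. Pos (idxWV nV nW t) (cs t) \<and>
                   ptrace (nW t) (cs t) = id_tensor (nV t) (cs (t - 1))" by blast
      then have "cs T \<in> combs Pos nV nW T 1" using Suc.IH[of "cs T"] by auto
      moreover have "Pos (idxWV nV nW (Suc T)) c" "ptrace (nW (Suc T)) c = id_tensor (nV (Suc T)) (cs T)"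
        using cs(3)[rule_format, of "Suc T"] cs(1) by simp_all
      ultimately show "c \<in> combs Pos nV nW (Suc T) 1" by auto
    next
      assume "c \<in> combs Pos nV nW (Suc T) 1"
      then obtain Y where Y: "Y \<in> combs Pos nV nW T 1" "Pos (idxWV nV nW (Suc T)) c"
         "ptrace (nW (Suc T)) c = id_tensor (nV (Suc T)) Y" by auto
      then obtain cs where cs: "cs T = Y" "cs 0 = unit_op" "\<forall>t\<in>{1..T}. Pos (idxWV nV nW t) (cs t) \<and>
                   ptrace (nW t) (cs t) = id_tensor (nV t) (cs (t - 1))" using Suc.IH[of Y] by blast
      show "?L (Suc T) c"
      proof (intro exI[of _ "cs(Suc T := c)"] conjI ballI)
        fix t assume "t \<in> {1..Suc T}"
        then consider "t = Suc T" | "t \<in> {1..T}" by force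
        then show "Pos (idxWV nV nW t) ((cs(Suc T := c)) t)"
          "ptrace (nW t) ((cs(Suc T := c)) t) = id_tensor (nV t) ((cs(Suc T := c)) (t - 1))"
          by (cases; use Y cs in \<open>auto simp del: idxWV.simps\<close>)+
      qed (use cs in auto)
    qed
  qed
  then show ?thesis by (auto simp: Chn_def)
qed

lemma SG_eq_cochains: "1 \<le> T \<Longrightarrow> SG T nV nW = cochains nV nW T 1"
proof -
  assume "1 \<le> T"
  then obtain T' where "T = Suc T'" by (cases T) auto
  \<comment> \<open>The induction starts at one time step, because the normalisation of
    \<open>tau 1\<close> is a clause of its own in \<open>SG\<close>, whereas
    \<open>cochains\<close> has it at level 0.\<close>
  moreover have "(\<exists>tau :: nat \<Rightarrow> op. \<phi> = id_tensor (nW (Suc T)) (tau (Suc T)) \<and> 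
      (\<forall>t\<in>{1..Suc T}. Pos (idxV nV nW t) (tau t)) \<and>
      ptrace (nV 1) (tau 1) = unit_op \<and>
      (\<forall>t\<in>{2..Suc T}. ptrace (nV t) (tau t) = id_tensor (nW (t - 1)) (tau (t - 1))))
      \<longleftrightarrow> \<phi> \<in> cochains nV nW (Suc T) 1" (is "?L T \<phi> \<longleftrightarrow> _") for T \<phi>
  proof (induction T arbitrary: \<phi>)
    case 0
    show ?case by (auto intro: exI[of _ "\<lambda>_. _"])
  next
    case (Suc T)
    show ?case
    proof
      assume "?L (Suc T) \<phi>"
      then obtain tau where tau: "\<phi> = id_tensor (nW (Suc (Suc T))) (tau (Suc (Suc T)))"
        "\<forall>t\<in>{1..Suc (Suc T)}. Pos (idxV nV nW t) (tau t)"
        "ptrace (nV 1) (tau 1) = unit_op"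
        "\<forall>t\<in>{2..Suc (Suc T)}. ptrace (nV t) (tau t) = id_tensor (nW (t - 1)) (tau (t - 1))" by blast
      have "id_tensor (nW (Suc T)) (tau (Suc T)) \<in> cochains nV nW (Suc T) 1"
        using tau by (intro iffD1[OF Suc.IH] exI[of _ tau]) auto
      moreover have "ptrace (nV (Suc (Suc T))) (tau (Suc (Suc T))) = id_tensor (nW (Suc T)) (tau (Suc T))"
        using tau(4)[rule_format, of "Suc (Suc T)"] by simp
      moreover have "Pos (idxV nV nW (Suc (Suc T))) (tau (Suc (Suc T)))" using tau(2) by simp
      ultimately show "\<phi> \<in> cochains nV nW (Suc (Suc T)) 1"
        by (subst cochains.simps(2), intro CollectI exI[of _ "tau (Suc (Suc T))"] conjI)
           (simp_all only: tau(1))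
    next
      assume "\<phi> \<in> cochains nV nW (Suc (Suc T)) 1"
      then obtain \<tau> where \<tau>: "\<phi> = id_tensor (nW (Suc (Suc T))) \<tau>" "Pos (idxV nV nW (Suc (Suc T))) \<tau>"
         "ptrace (nV (Suc (Suc T))) \<tau> \<in> cochains nV nW (Suc T) 1" by (subst (asm) cochains.simps(2)) blast
      then obtain tau where tau: "ptrace (nV (Suc (Suc T))) \<tau> = id_tensor (nW (Suc T)) (tau (Suc T))"
        "\<forall>t\<in>{1..Suc T}. Pos (idxV nV nW t) (tau t)"
        "ptrace (nV 1) (tau 1) = unit_op"
        "\<forall>t\<in>{2..Suc T}. ptrace (nV t) (tau t) = id_tensor (nW (t - 1)) (tau (t - 1))" 
        using Suc.IH[of "ptrace (nV (Suc (Suc T))) \<tau>"] by blast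
      show "?L (Suc T) \<phi>"
      proof (intro exI[of _ "tau(Suc (Suc T) := \<tau>)"] conjI ballI)
        fix t assume "t \<in> {1..Suc (Suc T)}"
        then consider "t = Suc (Suc T)" | "t \<in> {1..Suc T}" by force
        then show "Pos (idxV nV nW t) ((tau(Suc (Suc T) := \<tau>)) t)"
          by cases (use \<tau> tau in auto)
      next
        fix t assume "t \<in> {2..Suc (Suc T)}"
        then consider "t = Suc (Suc T)" | "t \<in> {2..Suc T}" by force
        then show "ptrace (nV t) ((tau(Suc (Suc T) := \<tau>)) t) = id_tensor (nW (t - 1)) ((tau(Suc (Suc T) := \<tau>)) (t - 1))"
          by cases (use \<tau> tau in auto)
      qed (use \<tau> tau in auto)
    qed
  qed
  ultimately show ?thesis by (auto simp only: SG_def)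
qed

lemma combs_Pos_scale:
  "X \<in> combs Pos nV nW t s \<Longrightarrow> 0 \<le> u \<Longrightarrow> scale_op u X \<in> combs Pos nV nW t (u * s)"
proof (induction t arbitrary: X)
  case 0 then show ?case by simp
next
  case (Suc t)
  then obtain Y where *: "Y \<in> combs Pos nV nW t s" "ptrace (nW (Suc t)) X = id_tensor (nV (Suc t)) Y"
     "Pos (idxWV nV nW (Suc t)) X" by auto
  have "ptrace (nW (Suc t)) (scale_op u X) = id_tensor (nV (Suc t)) (scale_op u Y)"
    by (simp add: ptrace_linear id_tensor_linear *)
  then show ?case using Suc.IH[OF *(1) Suc.prems(2)] Pos_scale[OF *(3) Suc.prems(2)]
    by (auto simp del: idxWV.simps)
qed

text \<open>Writes \<open>X\<close> as the difference of \<open>X\<close> plus \<open>k\<close> flat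
  combs, a multiple of a comb for large \<open>k\<close>, and \<open>k\<close> flat combs.\<close>

lemma combs_Her_subset_lin_span_Chn:
  assumes "\<forall>t\<in>{1..T}. 0 < nW t"
  shows "combs Her nV nW T s \<subseteq> lin_span (Chn T nV nW)"
proof
  fix X assume "X \<in> combs Her nV nW T s"
  then obtain k0 where k0: "\<forall>k\<ge>k0. add_op X (scale_op k (flat_comb nV nW T)) \<in> combs Pos nV nW T (s + k)"
    using combs_Her_plus_flat_comb[OF assms] by blast
  \<comment> \<open>The bound \<open>1 - s\<close> makes the level \<open>s + k\<close> at least 1,
    so that it can be normalised away.\<close>
  define k where "k = max k0 (1 - s)"
  define c where "c = scale_op (1 / (s + k)) (add_op X (scale_op k (flat_comb nV nW T)))"
  have sk: "s + k > 0" "k \<ge> k0" by (auto simp: k_def)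
  then have "c \<in> Chn T nV nW"
    using combs_Pos_scale[OF k0[rule_format, OF sk(2)], of "1 / (s + k)"]
    by (simp add: Chn_eq_combs c_def)
  moreover have "flat_comb nV nW T \<in> Chn T nV nW"
    using flat_comb_chain[OF assms] by (simp add: Chn_eq_combs)
  ultimately have "add_op (scale_op (s + k) c) (scale_op (- k) (flat_comb nV nW T)) \<in> lin_span (Chn T nV nW)"
    by (rule lin_span_lincomb2)
  also have "add_op (scale_op (s + k) c) (scale_op (- k) (flat_comb nV nW T)) = X"
    using sk(1) by (simp add: c_def) (simp add: op_defs)
  finally show "X \<in> lin_span (Chn T nV nW)" .
qed

text \<open>That the trace depends on the level alone bounds the positive part in
  \<open>dominating_comb\<close>, although the Hermitian combs of a level may be unbounded.\<close>

lemma trace_re_combs: "X \<in> combs Her nV nW t s \<Longrightarrow> trace_re (idxWV nV nW t) X = s * (\<Prod>t'=1..t. real (nV t'))"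
proof (induction t arbitrary: X)
  case 0 then show ?case by (simp add: trace_re_def op_defs unit_op_def)
next
  case (Suc t)
  then obtain Y where *: "Y \<in> combs Her nV nW t s" "ptrace (nW (Suc t)) X = id_tensor (nV (Suc t)) Y" by auto
  then show ?case using Suc.IH[OF *(1)] 
    by (simp add: idxWV_Suc trace_re_ptrace[of "nW _"] trace_re_id_tensor del: idxWV.simps)
qed

lemma trace_re_cochains: "\<phi> \<in> cochains nV nW t s \<Longrightarrow> trace_re (idxWV nV nW t) \<phi> = s * (\<Prod>t'=1..t. real (nW t'))"
proof (induction t arbitrary: \<phi>)
  case 0 then show ?case by (simp add: trace_re_def op_defs unit_op_def)
next
  case (Suc t)
  then obtain \<tau> where *: "\<phi> = id_tensor (nW (Suc t)) \<tau>" "ptrace (nV (Suc t)) \<tau> \<in> cochains nV nW t s" by auto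
  then show ?case using Suc.IH[OF *(2)] 
    by (simp add: idxWV_Suc trace_re_id_tensor trace_re_ptrace[of "nV _"] del: idxWV.simps)
qed

lemma zero_op_combs: "zero_op \<in> combs Her nV nW t 0"
proof (induction t)
  case 0 then show ?case by simp
next
  case (Suc t)
  have "ptrace (nW (Suc t)) zero_op = id_tensor (nV (Suc t)) zero_op"
    unfolding id_tensor_linear by (simp add: ptrace_def zero_op_def)
  then show ?case using Suc by (auto simp del: idxWV.simps)
qed

text \<open>Orthogonality to the kernel of the partial trace over \<open>W\<close> forces \<open>H\<close> to be \<open>I \<otimes> \<tau>\<close>; the
  remaining directions say that the partial trace of \<open>\<tau>\<close> over \<open>V\<close> satisfies the same hypothesis one level
  below.\<close>

lemma cochains_if_orthogonal:
  assumes "\<forall>t'\<in>{1..t}. 0 < nV t' \<and> 0 < nW t'" "Pos (idxWV nV nW t) H"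
    and "\<And>Y. Y \<in> combs Her nV nW t 0 \<Longrightarrow> inner_op (idxWV nV nW t) H Y = 0"
  shows "\<exists>s\<ge>0. H \<in> cochains nV nW t s"
  using assms
proof (induction t arbitrary: H)
  case 0
  then have H: "Her {[]} H" "0 \<le> Re (H [] [])" using Pos_diag[of "{[]}" H] by (auto simp: Pos_def)
  have "H i j = scale_op (Re (H [] [])) unit_op i j" for i j
    using Her_outside[OF H(1), of i j] Her_cnj[OF H(1), of "[]" "[]"]
    by (auto simp: scale_op_def unit_op_def complex_eq_iff)
  then have "H = scale_op (Re (H [] [])) unit_op" by (intro ext)
  then show ?case using H(2) by (intro exI[of _ "Re (H [] [])"]) simp
next
  case (Suc t)
  let ?X = "idxWV nV nW t" and ?n = "nV (Suc t)" and ?m = "nW (Suc t)"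
  have fin: "finite (cset ?n ?X)" by (intro finite_cset finite_idxWV)
  have pos: "0 < ?m" "0 < ?n" using Suc.prems(1) by auto
  have HP: "Pos (cset ?m (cset ?n ?X)) H" using Suc.prems(2) unfolding idxWV_Suc .
  have orth: "inner_op (cset ?m (cset ?n ?X)) H Y = 0"
    if "Her (cset ?m (cset ?n ?X)) Y" "Z \<in> combs Her nV nW t 0" "ptrace ?m Y = id_tensor ?n Z" for Y Z
    using Suc.prems(3)[of Y] that by (auto simp: idxWV_Suc simp del: idxWV.simps)
  define \<tau> where "\<tau> = scale_op (1 / ?m) (ptrace ?m H)"
  \<comment> \<open>Zero is a comb of level 0, so \<open>orth\<close> covers every direction with
    vanishing partial trace.\<close>
  have H: "H = id_tensor ?m \<tau>" unfolding \<tau>_def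
    using orth[OF _ zero_op_combs] id_tensor_if_orthogonal[OF fin pos(1) Pos_imp_Her[OF HP]]
    by (simp add: id_tensor_linear)
  have \<tau>: "Pos (cset ?n ?X) \<tau>" unfolding \<tau>_def using HP by (intro Pos_scale Pos_ptrace fin) auto
  have "inner_op ?X (ptrace ?n \<tau>) Z = 0" if Z: "Z \<in> combs Her nV nW t 0" for Z
  proof -
    \<comment> \<open>A lift of \<open>Z\<close> to this level: dividing by the dimension
      compensates the partial trace of the identity.\<close>
    define Y where "Y = scale_op (1 / ?m) (id_tensor ?m (id_tensor ?n Z))"
    have pY: "ptrace ?m Y = id_tensor ?n Z" using pos by (simp add: Y_def ptrace_linear ptrace_id_tensor)
    have "inner_op (cset ?m (cset ?n ?X)) H Y = 0"
      by (rule orth[OF _ Z pY]) (auto simp: Y_def intro!: Her_scale Her_id_tensor combs_Her[OF Z])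
    then show ?thesis
      by (simp add: H inner_op_id_tensor pY inner_op_commute[of _ \<tau>])
         (simp add: inner_op_commute)
  qed
  then obtain s where "s \<ge> 0" "ptrace ?n \<tau> \<in> cochains nV nW t s"
    using Suc.IH[OF _ Pos_ptrace[OF finite_idxWV \<tau>]] Suc.prems(1) by auto
  then show ?case using \<tau> H by (auto simp: idxV_Suc)
qed

section \<open>Dominating a Hermitian operator by a comb\<close>

lemma compact_coordinatewise:
  fixes K :: "'a \<Rightarrow> 'b::topological_space set"
  assumes "\<And>i. compact (K i)"
  shows "compact {f. \<forall>i. f i \<in> K i}"
proof -
  have "compactin (product_topology (\<lambda>i. euclidean) UNIV) (PiE UNIV K)"
    using assms by (simp add: compactin_PiE compactin_euclidean_iff)
  moreover have "PiE UNIV K = {f. \<forall>i. f i \<in> K i}" by (auto simp: PiE_def Pi_def)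
  ultimately show ?thesis by (simp add: euclidean_product_topology compactin_euclidean_iff)
qed

lemma compact_bounded_ops: "compact {A :: op. \<forall>i j. cmod (A i j) \<le> B}"
proof -
  have "compact {f :: nat list \<Rightarrow> complex. \<forall>j. f j \<in> cball 0 B}"
    by (intro compact_coordinatewise compact_cball)
  then have "compact {A :: op. \<forall>i. A i \<in> {f. \<forall>j. f j \<in> cball 0 B}}"
    by (rule compact_coordinatewise)
  then show ?thesis by simp
qed

lemma compact_bounded_tups: "compact {\<Phi> :: tup. \<forall>m i j. cmod (\<Phi> m i j) \<le> B}"
  using compact_coordinatewise[of "\<lambda>_. {A :: op. \<forall>i j. cmod (A i j) \<le> B}", OF compact_bounded_ops]
  by simp

lemma continuous_on_op_entry:
  "continuous_on S (\<lambda>x. f x) \<Longrightarrow> continuous_on S (\<lambda>x. (f x :: op) i j)"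
  by (rule continuous_on_product_then_coordinatewise[OF continuous_on_product_then_coordinatewise])

lemma continuous_on_tup_entry:
  "continuous_on S (\<lambda>x. f x) \<Longrightarrow> continuous_on S (\<lambda>x. (f x :: tup) m i j)"
  by (rule continuous_on_op_entry[OF continuous_on_product_then_coordinatewise])

lemma continuous_on_opI:
  "(\<And>i j. continuous_on S (\<lambda>x. (f x :: op) i j)) \<Longrightarrow> continuous_on S f"
  by (rule continuous_on_coordinatewise_then_product)+

lemma continuous_on_inner_op:
  assumes "continuous_on S f" "continuous_on S g"
  shows "continuous_on S (\<lambda>x. inner_op X (f x) (g x))"
  unfolding inner_op_def by (intro continuous_intros assms[THEN continuous_on_op_entry])

lemma continuous_on_diff_op:
  assumes "continuous_on S f" "continuous_on S g"
  shows "continuous_on S (\<lambda>x. diff_op (f x) (g x))"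
  unfolding diff_op_def
  by (rule continuous_on_opI) (intro continuous_intros assms[THEN continuous_on_op_entry])

lemma closed_Her: "closed {A. Her X A}"
proof -
  have "{A. Her X A} = (\<Inter>i. \<Inter>j. {A. cnj (A i j) = A j i} \<inter> (if i \<in> X \<and> j \<in> X then UNIV else {A. A i j = 0}))"
    unfolding Her_iff supp_in_def by (auto split: if_splits) metis+
  moreover have "closed (if P then UNIV else {A :: op. A i j = 0})" for P i j
    by (simp add: closed_Collect_eq continuous_on_op_entry[OF continuous_on_id])
  moreover have "closed {A :: op. cnj (A i j) = A j i}" for i j
    by (intro closed_Collect_eq continuous_on_cnj continuous_on_op_entry[OF continuous_on_id])
  ultimately show ?thesis by (auto intro!: closed_INT closed_Int)
qed

lemma closed_Pos: "closed {A. Pos X A}"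
proof -
  have "{A. Pos X A} = {A. Her X A} \<inter> (\<Inter>x. {A. 0 \<le> inner_op X A (rank_one X x)})"
    by (auto simp: Pos_iff inner_op_rank_one)
  moreover have "closed {A. 0 \<le> inner_op X A (rank_one X x)}" for x
    by (intro closed_Collect_le continuous_on_inner_op continuous_on_const continuous_on_id)
  ultimately show ?thesis by (auto intro!: closed_INT closed_Int closed_Her)
qed

lemma closed_combs_Her:
  assumes "\<forall>t'\<in>{1..t}. 0 < nV t'"
  shows "closed (combs Her nV nW t s)"
  using assms
proof (induction t)
  case 0 then show ?case by simp
next
  case (Suc t)
  \<comment> \<open>Reads the witness \<open>Y\<close> off a diagonal block of the partial trace.
    Block 0 exists because the input dimension is positive, and the existential quantifier becomes a
    continuous condition on \<open>X\<close>.\<close>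
  define f where "f X = (\<lambda>r r'. ptrace (nW (Suc t)) X (0 # r) (0 # r'))" for X
  have f: "f X = Y" if "ptrace (nW (Suc t)) X = id_tensor (nV (Suc t)) Y" for X Y
    using that Suc.prems by (auto simp: f_def fun_eq_iff)
  have pc: "continuous_on UNIV (\<lambda>X. ptrace n X i j)" for n i j
    unfolding ptrace_def by (intro continuous_on_sum continuous_on_op_entry[OF continuous_on_id])
  have cf: "continuous_on UNIV f" unfolding f_def by (rule continuous_on_opI) (rule pc)
  have ci: "continuous_on UNIV (\<lambda>X. id_tensor n (f X) i j)" for n i j
  proof (cases "\<exists>w r r'. i = w # r \<and> j = w # r' \<and> w < n")
    case True
    then show ?thesis by (auto intro: continuous_on_op_entry[OF cf])
  next
    case False
    then have "id_tensor n (f X) i j = 0" for X by (cases i; cases j) auto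
    then show ?thesis by simp
  qed
  have "combs Her nV nW (Suc t) s = {X. Her (idxWV nV nW (Suc t)) X} \<inter> f -` combs Her nV nW t s
     \<inter> {X. ptrace (nW (Suc t)) X = id_tensor (nV (Suc t)) (f X)}"
    using f by (auto simp del: idxWV.simps)
  moreover have "closed (f -` combs Her nV nW t s)"
    using Suc cf by (intro closed_vimage) auto
  moreover have "closed {X. ptrace (nW (Suc t)) X = id_tensor (nV (Suc t)) (f X)}"
    by (rule closed_Collect_eq; rule continuous_on_opI) (rule pc ci)+
  ultimately show ?case by (auto intro!: closed_Int closed_Her simp del: combs.simps idxWV.simps)
qed

lemma first_order_condition:
  fixes L Q :: real
  assumes "\<And>t. 0 < t \<Longrightarrow> t \<le> 1 \<Longrightarrow> 0 \<le> 2 * t * L + t\<^sup>2 * Q"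
  shows "0 \<le> L"
proof (rule ccontr)
  assume "\<not> 0 \<le> L"
  then have L: "L < 0" by simp
  \<comment> \<open>So small that the quadratic term cannot outweigh the negative linear
    one.\<close>
  define t where "t = min 1 (- L / (\<bar>Q\<bar> + 1))"
  have t: "0 < t" "t \<le> 1" using L by (auto simp: t_def divide_neg_pos)
  have "t * (\<bar>Q\<bar> + 1) \<le> - L"
    using mult_right_mono[of t "- L / (\<bar>Q\<bar> + 1)" "\<bar>Q\<bar> + 1"] by (simp add: t_def)
  moreover have "t * Q \<le> t * (\<bar>Q\<bar> + 1)" using t by (intro mult_left_mono) auto
  ultimately have "2 * L + t * Q < 0" using L by linarith
  then have "t * (2 * L + t * Q) < 0" using t by (simp add: mult_pos_neg)
  then show False using assms[OF t] by (simp add: power2_eq_square algebra_simps)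
qed

lemma inner_op_segment:
  "inner_op X (add_op (scale_op (1 - t) A) (scale_op t B)) (add_op (scale_op (1 - t) A) (scale_op t B))
    = inner_op X A A + 2 * t * inner_op X A (diff_op B A) + t\<^sup>2 * inner_op X (diff_op B A) (diff_op B A)"
  by (simp add: inner_op_linear inner_op_commute[of X B A] power2_eq_square algebra_simps)

text \<open>The bound \<open>1 + R\<close> stands in for the square root of
  \<open>R\<close>.\<close>

lemma Her_entry_bound:
  assumes "finite X" "Her X A" "inner_op X A A \<le> R"
  shows "cmod (A i j) \<le> 1 + R"
proof -
  have R: "0 \<le> R" using inner_op_self_nonneg[OF assms(2)] assms(3) by simp
  have "(cmod (A i j))\<^sup>2 \<le> R" using entry_le_inner_op_self[OF assms(1,2), of i j] assms(3) by linarith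
  also have "\<dots> \<le> (1 + R)\<^sup>2" using R by (simp add: power2_eq_square algebra_simps)
  finally show ?thesis by (rule power2_le_imp_le) (use R in simp)
qed

text \<open>Dual attainment in the case of all testers.  The distance from \<open>chi\<close> to the operators
  dominated by a Hermitian comb of level \<open>l\<close> is attained; the residual is positive and
  orthogonal to the directions of that affine space, so it is a multiple of an element of \<open>cochains\<close> and
  hence must vanish.\<close>

lemma dominating_comb:
  assumes dims: "\<forall>t\<in>{1..T}. 0 < nV t \<and> 0 < nW t"
    and chi: "Her (idxWV nV nW T) chi"
    and le: "\<And>\<phi>. \<phi> \<in> cochains nV nW T 1 \<Longrightarrow> inner_op (idxWV nV nW T) \<phi> chi \<le> l"
  shows "\<exists>Y\<in>combs Her nV nW T l. Pos (idxWV nV nW T) (diff_op Y chi)"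
proof -
  let ?I = "idxWV nV nW T"
  let ?C = "combs Her nV nW T l"
  define E where "E Y P = diff_op (diff_op Y P) chi" for Y P :: op
  define F where "F Y P = inner_op ?I (E Y P) (E Y P)" for Y P
  have E_Her: "Her ?I (E Y P)" if "Y \<in> ?C" "Pos ?I P" for Y P
    unfolding E_def using that chi by (intro Her_ops) (auto intro: combs_Her Pos_imp_Her)
  have lincomb: "add_op (scale_op u X) (scale_op v Y) \<in> combs Her nV nW T w"
    if "X \<in> combs Her nV nW T s" "Y \<in> combs Her nV nW T s'" "w = u * s + v * s'" for X Y u v s s' w
    using combs_lincomb[OF that(1,2), of u v] that(3) by simp
  define Y0 where "Y0 = add_op (scale_op l (flat_comb nV nW T)) (scale_op 0 (flat_comb nV nW T))"
  have "flat_comb nV nW T \<in> combs Her nV nW T 1"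
    using flat_comb_chain combs_Pos_Her dims by blast
  then have Y0: "Y0 \<in> ?C" unfolding Y0_def by (rule lincomb) (auto intro: \<open>flat_comb nV nW T \<in> _\<close>)
  define R where "R = F Y0 zero_op"
  \<comment> \<open>The trace of \<open>P\<close> is that of \<open>Y\<close>, fixed by the level,
    minus those of \<open>chi\<close> and of the residual; diagonal entries of the residual are at
    least \<open>-(1 + R)\<close>. Then \<open>b'\<close> bounds \<open>Y\<close> as residual plus
    \<open>P\<close> plus \<open>chi\<close>.\<close>
  define b where "b = l * (\<Prod>t'=1..T. real (nV t')) - trace_re ?I chi + real (card ?I) * (1 + R)"
  define b' where "b' = (1 + R) + b + (1 + inner_op ?I chi chi)"
  have bound: "cmod (P i j) \<le> b \<and> cmod (Y i j) \<le> b'"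
    if Y: "Y \<in> ?C" and P: "Pos ?I P" and FR: "F Y P \<le> R" for Y P i j
  proof -
    have e: "cmod (E Y P i j) \<le> 1 + R" for i j
      using Her_entry_bound[OF finite_idxWV E_Her[OF Y P]] FR by (simp add: F_def)
    have "- (1 + R) \<le> Re (E Y P i i)" for i using e[of i i] abs_Re_le_cmod[of "E Y P i i"] by linarith
    then have "(\<Sum>i\<in>?I. - (1 + R)) \<le> trace_re ?I (E Y P)" unfolding trace_re_def by (intro sum_mono)
    then have "trace_re ?I P \<le> b"
      using trace_re_combs[OF Y] by (simp add: E_def trace_re_linear b_def algebra_simps)
    then have p: "cmod (P i j) \<le> b" for i j
      using Pos_entry_le_trace[OF finite_idxWV P, of i j] by simp
    have "Y i j = E Y P i j + P i j + chi i j" by (simp add: E_def diff_op_def)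
    then have "cmod (Y i j) \<le> cmod (E Y P i j) + cmod (P i j) + cmod (chi i j)"
      by (metis add_mono_thms_linordered_semiring(3) norm_triangle_ineq norm_triangle_mono order_refl)
    also have "\<dots> \<le> b'" unfolding b'_def
      using e p Her_entry_bound[OF finite_idxWV chi order_refl] by (intro add_mono) auto
    finally show ?thesis using p by simp
  qed
  define K where "K = (?C \<inter> {A. \<forall>i j. cmod (A i j) \<le> b'}) \<times> ({A. Pos ?I A} \<inter> {A. \<forall>i j. cmod (A i j) \<le> b})"
  have "compact K" unfolding K_def
    using dims by (intro compact_Times closed_Int_compact closed_combs_Her closed_Pos compact_bounded_ops) auto
  moreover have "(Y0, zero_op) \<in> K"
    using bound[OF Y0 Pos_zero] Y0 by (auto simp: K_def R_def)
  moreover have "continuous_on K (\<lambda>p. F (fst p) (snd p))"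
    unfolding F_def E_def
    by (intro continuous_on_inner_op continuous_on_diff_op continuous_on_fst continuous_on_snd
        continuous_on_const continuous_on_id)
  ultimately obtain p where p: "p \<in> K" "\<And>q. q \<in> K \<Longrightarrow> F (fst p) (snd p) \<le> F (fst q) (snd q)"
    using continuous_attains_inf[of K "\<lambda>p. F (fst p) (snd p)"] by blast
  obtain X P where XP: "p = (X, P)" by (cases p)
  have X: "X \<in> ?C" and P: "Pos ?I P" using p(1) by (auto simp: K_def XP)
  have min: "F X P \<le> F Y Q" if "Y \<in> ?C" "Pos ?I Q" for Y Q
  proof (cases "F Y Q \<le> R")
    case True
    then have "(Y, Q) \<in> K" using bound[OF that] that by (auto simp: K_def)
    then show ?thesis using p(2) by (force simp: XP)
  next
    case False
    have "F X P \<le> R" using p(2)[OF \<open>(Y0, zero_op) \<in> K\<close>] by (simp add: XP R_def)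
    then show ?thesis using False by simp
  qed
  define E0 where "E0 = E X P"
  have var: "0 \<le> inner_op ?I E0 (diff_op (diff_op Y X) (diff_op Q P))"
    if Y: "Y \<in> ?C" and Q: "Pos ?I Q" for Y Q
  proof -
    have eq: "diff_op (E Y Q) E0 = diff_op (diff_op Y X) (diff_op Q P)"
      by (simp add: E0_def E_def diff_op_def fun_eq_iff)
    show ?thesis unfolding eq[symmetric]
    proof (rule first_order_condition)
      fix t :: real assume t: "0 < t" "t \<le> 1"
      have "E (add_op (scale_op (1 - t) X) (scale_op t Y)) (add_op (scale_op (1 - t) P) (scale_op t Q))
        = add_op (scale_op (1 - t) E0) (scale_op t (E Y Q))"
        by (simp add: E0_def E_def op_defs algebra_simps fun_eq_iff)
      moreover have "F X P \<le> F (add_op (scale_op (1 - t) X) (scale_op t Y)) (add_op (scale_op (1 - t) P) (scale_op t Q))"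
        using t by (intro min lincomb[OF X Y] Pos_add Pos_scale P Q) (auto simp: algebra_simps)
      ultimately show "0 \<le> 2 * t * inner_op ?I E0 (diff_op (E Y Q) E0) +
          t\<^sup>2 * inner_op ?I (diff_op (E Y Q) E0) (diff_op (E Y Q) E0)"
        by (simp add: F_def inner_op_segment flip: E0_def)
    qed
  qed
  \<comment> \<open>With this sign, adding positive operators to \<open>P\<close> shows that
    \<open>H\<close> is positive, shrinking \<open>P\<close> to zero gives a nonpositive pairing
    with \<open>P\<close>, and moving \<open>X\<close> both ways along level 0 gives
    orthogonality.\<close>
  define H where "H = scale_op (- 1) E0"
  have HerH: "Her ?I H" unfolding H_def E0_def by (intro Her_scale E_Her X P)
  have PosH: "Pos ?I H"
  proof (rule Pos_if_inner_nonneg[OF HerH])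
    fix Q assume Q: "Pos ?I Q"
    from var[OF X Pos_add[OF P Q]] show "0 \<le> inner_op ?I H Q"
      by (simp add: H_def inner_op_linear)
  qed
  have HP: "inner_op ?I H P \<le> 0"
    using var[OF X Pos_zero] by (simp add: H_def inner_op_linear)
  have orth: "inner_op ?I H Z = 0" if Z: "Z \<in> combs Her nV nW T 0" for Z
  proof -
    have "add_op (scale_op 1 X) (scale_op u Z) \<in> ?C" for u by (rule lincomb[OF X Z]) simp
    from var[OF this[of 1] P] var[OF this[of "- 1"] P] show ?thesis
      by (simp add: H_def inner_op_linear)
  qed
  obtain s where s: "s \<ge> 0" "H \<in> cochains nV nW T s"
    using cochains_if_orthogonal[OF dims PosH orth] by blast
  have HX: "inner_op ?I H X = s * l" by (rule inner_op_cochains_combs[OF s(2) X])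
  have "inner_op ?I H chi \<le> s * l"
  proof (cases "s = 0")
    case True
    have "trace_re ?I H = 0" using trace_re_cochains[OF s(2)] True by simp
    then have "H = zero_op" using Pos_entry_le_trace[OF finite_idxWV PosH] by (auto simp: zero_op_def fun_eq_iff)
    then show ?thesis using True by simp
  next
    case False
    then have "inner_op ?I (scale_op (1 / s) H) chi \<le> l"
      using cochains_scale[OF s(2), of "1 / s"] s(1) by (intro le) simp
    then show ?thesis using False s(1) by (simp add: inner_op_linear field_simps)
  qed
  \<comment> \<open>As \<open>H\<close> pairs to \<open>s * l\<close> with \<open>X\<close> and
    nonpositively with \<open>P\<close>, this identity and the bound just shown leave no room for a
    nonzero residual.\<close>
  moreover have "inner_op ?I H chi = inner_op ?I H X - inner_op ?I H P + inner_op ?I E0 E0"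
  proof -
    have "inner_op ?I H E0 = - inner_op ?I E0 E0" by (simp add: H_def inner_op_linear)
    moreover have "inner_op ?I H E0 = inner_op ?I H X - inner_op ?I H P - inner_op ?I H chi"
      unfolding E0_def E_def by (simp add: inner_op_linear)
    ultimately show ?thesis by simp
  qed
  ultimately have "inner_op ?I E0 E0 \<le> 0" using HX HP by simp
  then have "E0 = zero_op" using inner_op_self_zero[OF finite_idxWV] E_Her[OF X P] by (simp add: E0_def)
  then have "diff_op X chi = P" by (auto simp: E0_def E_def op_defs fun_eq_iff algebra_simps)
  then show ?thesis using X P by auto
qed

section \<open>Duality between (P) and (D)\<close>

lemma inner_op_sum_tup: "inner_op X (sum_tup M \<Phi>) A = (\<Sum>m<M. inner_op X (\<Phi> m) A)"
  by (simp add: sum_tup_def inner_op_sum_left)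

lemma inner_tup_lincomb:
  "inner_tup T nV nW M (\<lambda>m. add_op (scale_op u (\<Phi> m)) (scale_op v (\<Psi> m))) y
    = u * inner_tup T nV nW M \<Phi> y + v * inner_tup T nV nW M \<Psi> y"
  by (simp add: inner_tup_def inner_op_linear sum.distrib sum_distrib_left)

lemma inner_tup_scale: "inner_tup T nV nW M (\<lambda>m. scale_op u (\<Phi> m)) y = u * inner_tup T nV nW M \<Phi> y"
  by (simp add: inner_tup_def inner_op_linear sum_distrib_left)

lemma sum_tup_lincomb:
  "sum_tup M (\<lambda>m. add_op (scale_op u (\<Phi> m)) (scale_op v (\<Psi> m)))
    = add_op (scale_op u (sum_tup M \<Phi>)) (scale_op v (sum_tup M \<Psi>))"
  by (simp add: sum_tup_def op_defs sum.distrib sum_distrib_left)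

lemma sum_tup_scale: "sum_tup M (\<lambda>m. scale_op u (\<Phi> m)) = scale_op u (sum_tup M \<Phi>)"
  by (simp add: sum_tup_def op_defs sum_distrib_left)

lemma inner_tup_dual_slack:
  "inner_tup T nV nW M \<Phi> (\<lambda>m. if m < M then diff_op chi (zq J c a q m) else zero_op)
    = inner_op (idxWV nV nW T) (sum_tup M \<Phi>) chi - Pobj T nV nW M c \<Phi>
      + (\<Sum>j<J. q j * inner_tup T nV nW M \<Phi> (a j))"
proof -
  let ?I = "idxWV nV nW T"
  have z: "zq J c a q m = diff_op (c m) (\<lambda>i k. \<Sum>j<J. scale_op (q j) (a j m) i k)" for m
    by (simp add: zq_def diff_op_def scale_op_def)
  have "inner_op ?I (\<Phi> m) (diff_op chi (zq J c a q m)) =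
      inner_op ?I (\<Phi> m) chi - inner_op ?I (\<Phi> m) (c m) + (\<Sum>j<J. q j * inner_op ?I (\<Phi> m) (a j m))" for m
    unfolding z inner_op_diff_right inner_op_commute[of ?I "\<Phi> m" "\<lambda>i k. \<Sum>j<J. scale_op (q j) (a j m) i k"]
    by (simp add: inner_op_sum_left inner_op_scale_left inner_op_commute[of ?I "a _ m"])
  then have "inner_tup T nV nW M \<Phi> (\<lambda>m. if m < M then diff_op chi (zq J c a q m) else zero_op)
     = (\<Sum>m<M. inner_op ?I (\<Phi> m) chi - inner_op ?I (\<Phi> m) (c m) + (\<Sum>j<J. q j * inner_op ?I (\<Phi> m) (a j m)))"
    by (simp add: inner_tup_def)
  also have "\<dots> = inner_op ?I (sum_tup M \<Phi>) chi - Pobj T nV nW M c \<Phi>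
      + (\<Sum>m<M. \<Sum>j<J. q j * inner_op ?I (\<Phi> m) (a j m))"
    by (simp add: inner_op_sum_tup Pobj_def inner_tup_def sum.distrib sum_subtractf)
  also have "(\<Sum>m<M. \<Sum>j<J. q j * inner_op ?I (\<Phi> m) (a j m)) = (\<Sum>j<J. q j * inner_tup T nV nW M \<Phi> (a j))"
    by (subst sum.swap) (simp add: inner_tup_def sum_distrib_left)
  finally show ?thesis .
qed

lemma HerM_dual_slack:
  assumes "\<forall>m<M. Her (idxWV nV nW T) (c m)" "\<forall>j<J. \<forall>m<M. Her (idxWV nV nW T) (a j m)"
    "Her (idxWV nV nW T) chi"
  shows "(\<lambda>m. if m < M then diff_op chi (zq J c a q m) else zero_op) \<in> HerM T nV nW M"
proof -
  have "Her (idxWV nV nW T) (diff_op chi (zq J c a q m))" if "m < M" for m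
  proof -
    have z: "zq J c a q m = diff_op (c m) (\<lambda>i k. \<Sum>j<J. scale_op (q j) (a j m) i k)"
      by (simp add: zq_def diff_op_def scale_op_def)
    show ?thesis unfolding z using assms that by (intro Her_ops Her_sum Her_scale) auto
  qed
  then show ?thesis by (simp add: HerM_def)
qed

lemma SG_Pos: "1 \<le> T \<Longrightarrow> \<phi> \<in> SG T nV nW \<Longrightarrow> Pos (idxWV nV nW T) \<phi>"
  using cochains_Pos[of \<phi> nV nW T 1] by (simp add: SG_eq_cochains)

lemma SG_entry_bound:
  "1 \<le> T \<Longrightarrow> \<phi> \<in> SG T nV nW \<Longrightarrow> cmod (\<phi> i j) \<le> (\<Prod>t=1..T. real (nW t))"
  using Pos_entry_le_trace[OF finite_idxWV SG_Pos, of T \<phi> nV nW i j]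
    trace_re_cochains[of \<phi> nV nW T 1] by (simp add: SG_eq_cochains)

text \<open>\<open>lambdaS\<close> is a real-valued \<open>Sup\<close>, so its use as an upper bound
  requires boundedness of the pairings.\<close>

lemma bdd_above_inner_op_SG:
  assumes "1 \<le> T" "S \<subseteq> SG T nV nW"
  shows "bdd_above ((\<lambda>\<phi>. inner_op (idxWV nV nW T) \<phi> chi) ` S)"
proof -
  let ?I = "idxWV nV nW T"
  let ?b = "\<Prod>t=1..T. real (nW t)"
  have "inner_op ?I \<phi> chi \<le> (\<Sum>i\<in>?I. \<Sum>j\<in>?I. ?b * cmod (chi j i))" if "\<phi> \<in> S" for \<phi>
  proof -
    have "inner_op ?I \<phi> chi \<le> cmod (\<Sum>i\<in>?I. \<Sum>j\<in>?I. \<phi> i j * chi j i)"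
      unfolding inner_op_def by (rule complex_Re_le_cmod)
    also have "\<dots> \<le> (\<Sum>i\<in>?I. \<Sum>j\<in>?I. cmod (\<phi> i j * chi j i))"
      by (intro order_trans[OF norm_sum] sum_mono norm_sum)
    also have "\<dots> \<le> (\<Sum>i\<in>?I. \<Sum>j\<in>?I. ?b * cmod (chi j i))"
      unfolding norm_mult using SG_entry_bound[OF assms(1)] that assms(2)
      by (intro sum_mono mult_right_mono) auto
    finally show ?thesis .
  qed
  then show ?thesis by (intro bdd_aboveI2)
qed

lemma inner_op_le_lambdaS:
  "1 \<le> T \<Longrightarrow> S \<subseteq> SG T nV nW \<Longrightarrow> \<phi> \<in> S \<Longrightarrow> inner_op (idxWV nV nW T) \<phi> chi \<le> lambdaS T nV nW S chi"
  unfolding lambdaS_def by (intro cSUP_upper bdd_above_inner_op_SG)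

lemma lambdaS_le:
  "S \<noteq> {} \<Longrightarrow> (\<And>\<phi>. \<phi> \<in> S \<Longrightarrow> inner_op (idxWV nV nW T) \<phi> chi \<le> u) \<Longrightarrow> lambdaS T nV nW S chi \<le> u"
  unfolding lambdaS_def by (intro cSUP_least)

lemma lambdaS_mono:
  "1 \<le> T \<Longrightarrow> S \<noteq> {} \<Longrightarrow> S \<subseteq> S' \<Longrightarrow> S' \<subseteq> SG T nV nW \<Longrightarrow> lambdaS T nV nW S chi \<le> lambdaS T nV nW S' chi"
  by (intro lambdaS_le inner_op_le_lambdaS) auto

lemma weak_duality:
  assumes "1 \<le> T" "S \<subseteq> SG T nV nW" "p \<in> Dfeas T nV nW M J c a C"
    and "\<Phi> \<in> C" "sum_tup M \<Phi> \<in> S" "\<forall>j<J. eta T nV nW M a b j \<Phi> \<le> 0"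
  shows "Pobj T nV nW M c \<Phi> \<le> Dobj T nV nW J b S p"
proof -
  obtain chi q where p: "p = (chi, q)" by (cases p)
  have "0 \<le> inner_tup T nV nW M \<Phi> (\<lambda>m. if m < M then diff_op chi (zq J c a q m) else zero_op)"
    using assms(3,4) by (auto simp: Dfeas_def p dual_cone_def)
  then have "Pobj T nV nW M c \<Phi> \<le> inner_op (idxWV nV nW T) (sum_tup M \<Phi>) chi
      + (\<Sum>j<J. q j * inner_tup T nV nW M \<Phi> (a j))"
    by (simp add: inner_tup_dual_slack)
  also have "\<dots> \<le> lambdaS T nV nW S chi + (\<Sum>j<J. q j * b j)"
    using assms(3,6) by (intro add_mono inner_op_le_lambdaS assms sum_mono mult_left_mono)
      (auto simp: Dfeas_def p eta_def)
  finally show ?thesis by (simp add: Dobj_def p)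
qed

lemma continuous_on_inner_tup:
  assumes "continuous_on S f"
  shows "continuous_on S (\<lambda>x. inner_tup T nV nW M (f x) y)"
  unfolding inner_tup_def
  by (intro continuous_on_sum continuous_on_inner_op continuous_on_const
      continuous_on_product_then_coordinatewise[OF assms])

lemma continuous_on_sum_tup:
  assumes "continuous_on S f"
  shows "continuous_on S (\<lambda>x. sum_tup M (f x))"
  unfolding sum_tup_def
  by (rule continuous_on_opI) (intro continuous_on_sum continuous_on_tup_entry[OF assms])

text \<open>No Slater condition is needed for the equality of the two values: minimise the penalty
  \<open>|\<Sum>\<Phi> - \<phi>|\<^sup>2 + \<Sum>\<^sub>j max 0 \<eta>\<^sub>j(\<Phi>)\<^sup>2 + (max 0 (v - P(\<Phi>)))\<^sup>2\<close> over \<open>C \<times> S\<close>; the minimum is positive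
  and attained since \<open>C\<close> consists of positive tuples and \<open>S\<close> is compact, and the gradient of the
  penalty at a minimiser is, after normalisation, the required dual point.\<close>

lemma strong_duality:
  assumes T: "1 \<le> T"
    and c_her: "\<forall>m<M. Her (idxWV nV nW T) (c m)"
    and a_her: "\<forall>j<J. \<forall>m<M. Her (idxWV nV nW T) (a j m)"
    and C: "closed C" "convex_tups C" "cone_tups C" "C \<subseteq> CG T nV nW M"
    and S: "closed S" "convex_ops S" "S \<subseteq> SG T nV nW"
    and ref: "\<Phi>r \<in> C" "sum_tup M \<Phi>r \<in> S" "\<forall>j<J. eta T nV nW M a b j \<Phi>r \<le> 0"
    and v: "\<And>\<Phi>. \<Phi> \<in> C \<Longrightarrow> sum_tup M \<Phi> \<in> S \<Longrightarrow> \<forall>j<J. eta T nV nW M a b j \<Phi> \<le> 0 \<Longrightarrow>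
       Pobj T nV nW M c \<Phi> < v"
  shows "\<exists>p\<in>Dfeas T nV nW M J c a C. Dobj T nV nW J b S p \<le> v"
proof -
  let ?I = "idxWV nV nW T"
  let ?ip = "inner_op ?I"
  let ?\<eta> = "eta T nV nW M a b"
  let ?P = "Pobj T nV nW M c"
  define D where "D \<Phi> \<phi> = diff_op (sum_tup M \<Phi>) \<phi>" for \<Phi> \<phi>
  define F where "F \<Phi> \<phi> = ?ip (D \<Phi> \<phi>) (D \<Phi> \<phi>) + (\<Sum>j<J. (max 0 (?\<eta> j \<Phi>))\<^sup>2) + (max 0 (v - ?P \<Phi>))\<^sup>2" for \<Phi> \<phi>
  define R where "R = F \<Phi>r (sum_tup M \<Phi>r)"
  define \<beta> where "\<beta> = (\<Prod>t=1..T. real (nW t))"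
  have S_bound: "cmod (\<phi> i j) \<le> \<beta>" if "\<phi> \<in> S" for \<phi> i j
    using SG_entry_bound[OF T] that S(3) by (auto simp: \<beta>_def)
  have C_Pos: "Pos ?I (\<Phi> m)" if "\<Phi> \<in> C" for \<Phi> m
    using that C(4) by (cases "m < M") (auto simp: CG_def)
  have D_Her: "Her ?I (D \<Phi> \<phi>)" if "\<Phi> \<in> C" "\<phi> \<in> S" for \<Phi> \<phi>
    unfolding D_def sum_tup_def using that S(3)
    by (intro Her_ops Her_sum Pos_imp_Her[OF C_Pos] Pos_imp_Her[OF SG_Pos[OF T]]) auto
  \<comment> \<open>Each \<open>\<Phi> m\<close> is positive, so its diagonal lies below that of the
    sum, which is close to an element of \<open>S\<close>; its trace then bounds all its
    entries.\<close>
  define B where "B = real (card ?I) * (\<beta> + (1 + R))"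
  have bound: "cmod (\<Phi> m i j) \<le> B"
    if \<Phi>: "\<Phi> \<in> C" and \<phi>: "\<phi> \<in> S" and FR: "F \<Phi> \<phi> \<le> R" for \<Phi> \<phi> m i j
  proof -
    have "?ip (D \<Phi> \<phi>) (D \<Phi> \<phi>) \<le> R"
    proof -
      have "0 \<le> (\<Sum>j<J. (max 0 (?\<eta> j \<Phi>))\<^sup>2)" by (simp add: sum_nonneg)
      then show ?thesis using FR zero_le_power2[of "max 0 (v - ?P \<Phi>)"] unfolding F_def by linarith
    qed
    then have d: "cmod (D \<Phi> \<phi> i j) \<le> 1 + R" for i j
      using Her_entry_bound[OF finite_idxWV D_Her[OF \<Phi> \<phi>]] by simp
    have diag: "Re (sum_tup M \<Phi> i i) \<le> \<beta> + (1 + R)" for i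
    proof -
      have "Re (sum_tup M \<Phi> i i) = Re (\<phi> i i) + Re (D \<Phi> \<phi> i i)" by (simp add: D_def diff_op_def)
      also have "\<dots> \<le> \<beta> + (1 + R)"
        using d[of i i] S_bound[OF \<phi>, of i i] complex_Re_le_cmod[of "D \<Phi> \<phi> i i"] complex_Re_le_cmod[of "\<phi> i i"]
        by linarith
      finally show ?thesis .
    qed
    show ?thesis
    proof (cases "m < M")
      case True
      have "Re (\<Phi> m i i) \<le> \<beta> + (1 + R)" for i
      proof -
        have "Re (\<Phi> m i i) \<le> (\<Sum>m<M. Re (\<Phi> m i i))"
          using True Pos_diag[OF finite_idxWV C_Pos[OF \<Phi>]]
          by (intro member_le_sum[of m "{..<M}" "\<lambda>m. Re (\<Phi> m i i)"]) auto
        also have "\<dots> \<le> \<beta> + (1 + R)" using diag[of i] by (simp add: sum_tup_def)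
        finally show ?thesis .
      qed
      then have "trace_re ?I (\<Phi> m) \<le> (\<Sum>i\<in>?I. \<beta> + (1 + R))" unfolding trace_re_def by (intro sum_mono)
      then show ?thesis
        using Pos_entry_le_trace[OF finite_idxWV C_Pos[OF \<Phi>], of m i j] by (simp add: B_def)
    next
      case False
      then have "\<Phi> m = zero_op" using \<Phi> C(4) by (auto simp: CG_def)
      moreover have "0 \<le> \<beta> + (1 + R)"
        using d[of i j] norm_ge_zero[of "D \<Phi> \<phi> i j"] S_bound[OF \<phi>, of i j] norm_ge_zero[of "\<phi> i j"] by linarith
      ultimately show ?thesis by (simp add: zero_op_def B_def)
    qed
  qed
  define K where "K = (C \<inter> {\<Phi>. \<forall>m i j. cmod (\<Phi> m i j) \<le> B}) \<times> (S \<inter> {A. \<forall>i j. cmod (A i j) \<le> \<beta>})"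
  have "compact K" unfolding K_def
    by (intro compact_Times closed_Int_compact C S compact_bounded_ops compact_bounded_tups)
  moreover have refK: "(\<Phi>r, sum_tup M \<Phi>r) \<in> K"
    using bound[OF ref(1,2)] ref S_bound by (auto simp: K_def R_def)
  moreover have "continuous_on K (\<lambda>p. F (fst p) (snd p))"
    unfolding F_def D_def eta_def Pobj_def
    by (intro continuous_on_add continuous_on_sum continuous_on_power continuous_on_max continuous_on_diff
        continuous_on_const continuous_on_inner_tup continuous_on_inner_op continuous_on_diff_op
        continuous_on_sum_tup continuous_on_fst continuous_on_snd continuous_on_id)
  ultimately obtain p where p: "p \<in> K" "\<And>q. q \<in> K \<Longrightarrow> F (fst p) (snd p) \<le> F (fst q) (snd q)"
    using continuous_attains_inf[of K "\<lambda>p. F (fst p) (snd p)"] by blast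
  obtain \<Phi>0 \<phi>0 where p0: "p = (\<Phi>0, \<phi>0)" by (cases p)
  have \<Phi>0: "\<Phi>0 \<in> C" and \<phi>0: "\<phi>0 \<in> S" using p(1) by (auto simp: K_def p0)
  have min: "F \<Phi>0 \<phi>0 \<le> F \<Phi> \<phi>" if "\<Phi> \<in> C" "\<phi> \<in> S" for \<Phi> \<phi>
  proof (cases "F \<Phi> \<phi> \<le> R")
    case True
    then have "(\<Phi>, \<phi>) \<in> K" using bound[OF that True] that S_bound by (auto simp: K_def)
    then show ?thesis using p(2) by (force simp: p0)
  next
    case False
    then show ?thesis using p(2)[OF refK] by (simp add: p0 R_def)
  qed
  \<comment> \<open>Up to sign, \<open>D0\<close>, \<open>q\<close> and \<open>\<alpha>\<close> are
    half the derivatives of the three penalty terms at the minimiser; \<open>G\<close> is half the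
    derivative in the direction of a tuple.\<close>
  define D0 where "D0 = D \<Phi>0 \<phi>0"
  define q where "q j = max 0 (?\<eta> j \<Phi>0)" for j
  define \<alpha> where "\<alpha> = max 0 (v - ?P \<Phi>0)"
  define G where "G \<Phi> = ?ip (sum_tup M \<Phi>) D0 + (\<Sum>j<J. q j * inner_tup T nV nW M \<Phi> (a j)) - \<alpha> * ?P \<Phi>" for \<Phi>
  have q0: "q j \<ge> 0" for j by (simp add: q_def)
  \<comment> \<open>Replaces the squared positive part by a quadratic in \<open>t\<close> that lies
    above it and agrees with it at \<open>t = 0\<close>, so no derivative has to be taken.\<close>
  have sq_max: "(max 0 (x + t * (y - x)))\<^sup>2 \<le> (max 0 x + t * (y - x))\<^sup>2" for x y t :: real
    by (rule abs_le_square_iff[THEN iffD1]) (simp add: max_def)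
  have var: "?ip \<phi> D0 - ?ip \<phi>0 D0 \<le> G \<Phi> - G \<Phi>0" if \<Phi>: "\<Phi> \<in> C" and \<phi>: "\<phi> \<in> S" for \<Phi> \<phi>
  proof -
    define E where "E = diff_op (D \<Phi> \<phi>) D0"
    define h where "h j = ?\<eta> j \<Phi> - ?\<eta> j \<Phi>0" for j
    define k where "k = ?P \<Phi>0 - ?P \<Phi>"
    define L where "L = ?ip D0 E + (\<Sum>j<J. q j * h j) + \<alpha> * k"
    have "0 \<le> L"
    proof (rule first_order_condition)
      fix t :: real assume t: "0 < t" "t \<le> 1"
      define \<Phi>t where "\<Phi>t = (\<lambda>m. add_op (scale_op (1 - t) (\<Phi>0 m)) (scale_op t (\<Phi> m)))"
      define \<phi>t where "\<phi>t = add_op (scale_op (1 - t) \<phi>0) (scale_op t \<phi>)"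
      have "\<Phi>t \<in> C" using C(2)[unfolded convex_tups_def, rule_format, OF \<Phi>0 \<Phi>, of "1 - t"] t
        by (simp add: \<Phi>t_def)
      moreover have "\<phi>t \<in> S" using S(2)[unfolded convex_ops_def, rule_format, OF \<phi>0 \<phi>, of "1 - t"] t
        by (simp add: \<phi>t_def)
      ultimately have le: "F \<Phi>0 \<phi>0 \<le> F \<Phi>t \<phi>t" by (rule min)
      have "D \<Phi>t \<phi>t = add_op (scale_op (1 - t) D0) (scale_op t (D \<Phi> \<phi>))"
        unfolding D0_def D_def \<Phi>t_def \<phi>t_def sum_tup_lincomb by (simp add: op_defs algebra_simps)
      then have 1: "?ip (D \<Phi>t \<phi>t) (D \<Phi>t \<phi>t) = ?ip D0 D0 + 2 * t * ?ip D0 E + t\<^sup>2 * ?ip E E"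
        by (simp add: inner_op_segment E_def)
      have "?\<eta> j \<Phi>t = ?\<eta> j \<Phi>0 + t * (?\<eta> j \<Phi> - ?\<eta> j \<Phi>0)" for j
        unfolding eta_def \<Phi>t_def inner_tup_lincomb by (simp add: algebra_simps)
      then have "(\<Sum>j<J. (max 0 (?\<eta> j \<Phi>t))\<^sup>2) \<le> (\<Sum>j<J. (q j + t * h j)\<^sup>2)"
        by (simp add: q_def h_def sum_mono sq_max)
      also have "\<dots> = (\<Sum>j<J. (q j)\<^sup>2) + 2 * t * (\<Sum>j<J. q j * h j) + t\<^sup>2 * (\<Sum>j<J. (h j)\<^sup>2)"
        by (simp add: power2_sum power_mult_distrib sum.distrib sum_distrib_left mult_ac)
      finally have 2: "(\<Sum>j<J. (max 0 (?\<eta> j \<Phi>t))\<^sup>2) \<le> \<dots>" .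
      have "v - ?P \<Phi>t = (v - ?P \<Phi>0) + t * ((v - ?P \<Phi>) - (v - ?P \<Phi>0))"
        unfolding Pobj_def \<Phi>t_def inner_tup_lincomb by (simp add: algebra_simps)
      then have "(max 0 (v - ?P \<Phi>t))\<^sup>2 \<le> (\<alpha> + t * k)\<^sup>2"
        using sq_max[of "v - ?P \<Phi>0" t "v - ?P \<Phi>"] by (simp only: \<alpha>_def k_def) simp
      also have "\<dots> = \<alpha>\<^sup>2 + 2 * t * (\<alpha> * k) + t\<^sup>2 * k\<^sup>2"
        by (simp add: power2_sum power_mult_distrib)
      finally have 3: "(max 0 (v - ?P \<Phi>t))\<^sup>2 \<le> \<dots>" .
      have "F \<Phi>0 \<phi>0 = ?ip D0 D0 + (\<Sum>j<J. (q j)\<^sup>2) + \<alpha>\<^sup>2"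
        by (simp add: F_def D0_def q_def \<alpha>_def)
      with le 1 2 3 show "0 \<le> 2 * t * L + t\<^sup>2 * (?ip E E + (\<Sum>j<J. (h j)\<^sup>2) + k\<^sup>2)"
        unfolding L_def F_def[of \<Phi>t] by (simp add: algebra_simps)
    qed
    moreover have "L = (G \<Phi> - G \<Phi>0) - (?ip \<phi> D0 - ?ip \<phi>0 D0)"
    proof -
      have "?ip D0 E = (?ip (sum_tup M \<Phi>) D0 - ?ip \<phi> D0) - (?ip (sum_tup M \<Phi>0) D0 - ?ip \<phi>0 D0)"
      proof -
        have "E = diff_op (diff_op (sum_tup M \<Phi>) \<phi>) (diff_op (sum_tup M \<Phi>0) \<phi>0)"
          by (simp add: E_def D0_def D_def)
        then show ?thesis by (simp add: inner_op_linear inner_op_commute[of ?I D0])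
      qed
      moreover have "(\<Sum>j<J. q j * h j) = (\<Sum>j<J. q j * inner_tup T nV nW M \<Phi> (a j))
          - (\<Sum>j<J. q j * inner_tup T nV nW M \<Phi>0 (a j))"
        by (simp add: h_def eta_def right_diff_distrib sum_subtractf)
      ultimately show ?thesis by (simp add: L_def G_def k_def algebra_simps)
    qed
    ultimately show ?thesis by simp
  qed
  have scaled: "(\<lambda>m. scale_op u (\<Phi>0 m)) \<in> C" if "0 \<le> u" for u
    using C(3) \<Phi>0 that by (auto simp: cone_tups_def)
  have G_scale: "G (\<lambda>m. scale_op u (\<Phi>0 m)) = u * G \<Phi>0" for u
    by (simp add: G_def sum_tup_scale inner_tup_scale Pobj_def inner_op_linear algebra_simps sum_distrib_left)
  \<comment> \<open>In the cone \<open>C\<close> the minimiser may be scaled by 0 and by 2, which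
    bounds \<open>G \<Phi>0\<close> from both sides. This is complementary slackness.\<close>
  have G0: "G \<Phi>0 = 0"
    using var[OF scaled[of 0] \<phi>0] var[OF scaled[of 2] \<phi>0] unfolding G_scale by simp
  have G_nonneg: "0 \<le> G \<Phi>" if "\<Phi> \<in> C" for \<Phi> using var[OF that \<phi>0] G0 by simp
  have \<phi>0_max: "?ip \<phi> D0 \<le> ?ip \<phi>0 D0" if "\<phi> \<in> S" for \<phi> using var[OF \<Phi>0 that] by simp
  have qq: "q j * ?\<eta> j \<Phi>0 = (q j)\<^sup>2" for j by (simp add: q_def max_def power2_eq_square)
  have q_eta: "(\<Sum>j<J. q j * ?\<eta> j \<Phi>) = (\<Sum>j<J. q j * inner_tup T nV nW M \<Phi> (a j)) - (\<Sum>j<J. q j * b j)" for \<Phi>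
    by (simp add: eta_def right_diff_distrib sum_subtractf)
  have D0D0: "?ip D0 D0 = ?ip (sum_tup M \<Phi>0) D0 - ?ip \<phi>0 D0"
    by (subst (1) D0_def) (simp add: D_def inner_op_linear)
  have value_eq: "?ip \<phi>0 D0 + (\<Sum>j<J. q j * b j) = \<alpha> * ?P \<Phi>0 - ?ip D0 D0 - (\<Sum>j<J. (q j)\<^sup>2)"
    using G0 q_eta[of \<Phi>0] D0D0 by (simp add: G_def qq)
  have D0_nonneg: "0 \<le> ?ip D0 D0" using inner_op_self_nonneg[OF D_Her[OF \<Phi>0 \<phi>0]] by (simp add: D0_def)
  \<comment> \<open>If \<open>\<alpha> = 0\<close>, comparison with the feasible
    \<open>\<Phi>r\<close> makes the other penalties vanish, so \<open>\<Phi>0\<close> is feasible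
    with objective at least \<open>v\<close>.\<close>
  have "\<alpha> > 0"
  proof (rule ccontr)
    assume "\<not> \<alpha> > 0"
    then have \<alpha>: "\<alpha> = 0" "v \<le> ?P \<Phi>0" by (auto simp: \<alpha>_def max_def split: if_splits)
    have "0 \<le> (\<Sum>j<J. q j * inner_tup T nV nW M \<Phi>r (a j)) + ?ip \<phi>0 D0"
      using var[OF ref(1,2)] G0 \<alpha> by (simp add: G_def)
    then have "0 \<le> (\<Sum>j<J. q j * ?\<eta> j \<Phi>r) - ?ip D0 D0 - (\<Sum>j<J. (q j)\<^sup>2)"
      using value_eq q_eta[of \<Phi>r] \<alpha> by simp
    moreover have "(\<Sum>j<J. q j * ?\<eta> j \<Phi>r) \<le> 0"
      using ref(3) q0 by (auto intro!: sum_nonpos mult_nonneg_nonpos)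
    moreover have "0 \<le> (\<Sum>j<J. (q j)\<^sup>2)" by (simp add: sum_nonneg)
    ultimately have z: "?ip D0 D0 \<le> 0" "(\<Sum>j<J. (q j)\<^sup>2) = 0" using D0_nonneg by linarith+
    have "D0 = zero_op" using inner_op_self_zero[OF finite_idxWV _ z(1)] D_Her[OF \<Phi>0 \<phi>0] by (simp add: D0_def)
    then have "sum_tup M \<Phi>0 = \<phi>0" by (auto simp: D0_def D_def op_defs fun_eq_iff)
    moreover have "\<forall>j<J. ?\<eta> j \<Phi>0 \<le> 0"
    proof (intro allI impI)
      fix j assume "j < J"
      then have "q j = 0" using z(2) by (subst (asm) sum_nonneg_eq_0_iff) auto
      then show "?\<eta> j \<Phi>0 \<le> 0" by (simp add: q_def max_def split: if_splits)
    qed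
    ultimately show False using v[OF \<Phi>0] \<phi>0 \<alpha>(2) by auto
  qed
  then have Pv: "?P \<Phi>0 \<le> v" by (auto simp: \<alpha>_def max_def split: if_splits)
  define chi where "chi = scale_op (1 / \<alpha>) D0"
  \<comment> \<open>\<open>Dfeas\<close> requires zero beyond \<open>J\<close>, where
    \<open>q\<close> need not vanish.\<close>
  define q' where "q' j = (if j < J then q j / \<alpha> else 0)" for j
  have q'sum: "(\<Sum>j<J. q' j * f j) = (\<Sum>j<J. q j * f j) / \<alpha>" for f
    by (simp add: q'_def sum_divide_distrib)
  have chi: "Her ?I chi" unfolding chi_def D0_def by (intro Her_scale D_Her \<Phi>0 \<phi>0)
  have "0 \<le> inner_tup T nV nW M \<Phi> (\<lambda>m. if m < M then diff_op chi (zq J c a q' m) else zero_op)" if "\<Phi> \<in> C" for \<Phi>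
  proof -
    have "inner_tup T nV nW M \<Phi> (\<lambda>m. if m < M then diff_op chi (zq J c a q' m) else zero_op) = G \<Phi> / \<alpha>"
      unfolding inner_tup_dual_slack q'sum using \<open>\<alpha> > 0\<close>
      by (simp add: chi_def inner_op_linear G_def field_simps)
    then show ?thesis using G_nonneg[OF that] \<open>\<alpha> > 0\<close> by simp
  qed
  then have "(chi, q') \<in> Dfeas T nV nW M J c a C"
    using HerM_dual_slack[OF c_her a_her chi] chi q0 \<open>\<alpha> > 0\<close>
    by (auto simp: Dfeas_def dual_cone_def q'_def)
  moreover have "Dobj T nV nW J b S (chi, q') \<le> v"
  proof -
    have "lambdaS T nV nW S chi \<le> ?ip \<phi>0 D0 / \<alpha>"
      using \<phi>0 \<phi>0_max \<open>\<alpha> > 0\<close> by (intro lambdaS_le) (auto simp: chi_def inner_op_linear divide_right_mono)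
    then have "Dobj T nV nW J b S (chi, q') \<le> (?ip \<phi>0 D0 + (\<Sum>j<J. q j * b j)) / \<alpha>"
      by (simp add: Dobj_def q'sum add_divide_distrib)
    also have "\<dots> \<le> \<alpha> * ?P \<Phi>0 / \<alpha>"
      unfolding value_eq using \<open>\<alpha> > 0\<close> D0_nonneg sum_nonneg[of "{..<J}" "\<lambda>j. (q j)\<^sup>2"]
      by (intro divide_right_mono) simp_all
    also have "\<dots> \<le> v" using \<open>\<alpha> > 0\<close> Pv by simp
    finally show ?thesis .
  qed
  ultimately show ?thesis by blast
qed

text \<open>Weak and strong duality concern the closed problem over \<open>C\<close> and
  \<open>S\<close>. Its feasible set is the closure of that of (P), and upper bounds on the
  continuous objective extend to the closure.\<close>

lemma Pval_eq_Dobj: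
  assumes T: "1 \<le> T"
    and her: "\<forall>m<M. Her (idxWV nV nW T) (c m)" "\<forall>j<J. \<forall>m<M. Her (idxWV nV nW T) (a j m)"
    and C: "closed C \<and> convex_tups C \<and> cone_tups C" "C \<subseteq> CG T nV nW M"
    and S: "closed S \<and> convex_ops S" "S \<subseteq> SG T nV nW"
    and cl: "closure TT = {\<Phi> \<in> C. sum_tup M \<Phi> \<in> S}"
    and Pcl: "closure (Pfeas T nV nW M J a b TT) = {\<Phi> \<in> closure TT. \<forall>j<J. eta T nV nW M a b j \<Phi> \<le> 0}"
    and ne: "Pfeas T nV nW M J a b TT \<noteq> {}"
    and opt: "Dopt T nV nW M J c a b C S p"
  shows "Pval T nV nW M J c a b TT = ereal (Dobj T nV nW J b S p)"
proof (rule antisym)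
  let ?P = "Pobj T nV nW M c"
  have feas: "\<Phi> \<in> closure (Pfeas T nV nW M J a b TT) \<longleftrightarrow>
      \<Phi> \<in> C \<and> sum_tup M \<Phi> \<in> S \<and> (\<forall>j<J. eta T nV nW M a b j \<Phi> \<le> 0)" for \<Phi>
    unfolding Pcl cl by auto
  have p: "p \<in> Dfeas T nV nW M J c a C" using opt by (simp add: Dopt_def)
  show "Pval T nV nW M J c a b TT \<le> ereal (Dobj T nV nW J b S p)"
    unfolding Pval_def
  proof (rule SUP_least)
    fix \<Phi> assume "\<Phi> \<in> Pfeas T nV nW M J a b TT"
    then have "\<Phi> \<in> closure (Pfeas T nV nW M J a b TT)" using closure_subset by blast
    then show "ereal (?P \<Phi>) \<le> ereal (Dobj T nV nW J b S p)"
      using weak_duality[OF T S(2) p] feas by auto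
  qed
  show "ereal (Dobj T nV nW J b S p) \<le> Pval T nV nW M J c a b TT"
  proof (rule ccontr)
    assume "\<not> ?thesis"
    then have "Pval T nV nW M J c a b TT < ereal (Dobj T nV nW J b S p)" by simp
    then obtain r where r: "Pval T nV nW M J c a b TT < ereal r" "ereal r < ereal (Dobj T nV nW J b S p)"
      using ereal_dense2 by blast
    have "Pfeas T nV nW M J a b TT \<subseteq> {\<Phi>. ?P \<Phi> \<le> r}"
    proof
      fix \<Phi> assume "\<Phi> \<in> Pfeas T nV nW M J a b TT"
      then have "ereal (?P \<Phi>) \<le> Pval T nV nW M J c a b TT" unfolding Pval_def by (rule SUP_upper)
      then have "ereal (?P \<Phi>) < ereal r" using r(1) by (rule le_less_trans)
      then show "\<Phi> \<in> {\<Phi>. ?P \<Phi> \<le> r}" by simp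
    qed
    moreover have "closed {\<Phi>. ?P \<Phi> \<le> r}"
      unfolding Pobj_def by (intro closed_Collect_le continuous_on_inner_tup continuous_on_id continuous_on_const)
    ultimately have le: "closure (Pfeas T nV nW M J a b TT) \<subseteq> {\<Phi>. ?P \<Phi> \<le> r}" by (rule closure_minimal)
    \<comment> \<open>A midpoint, because the closure yields only the weak bound \<open>r\<close>
      while \<open>strong_duality\<close> asks for a strict one.\<close>
    define v where "v = (r + Dobj T nV nW J b S p) / 2"
    have v: "r < v" "v < Dobj T nV nW J b S p" using r(2) by (auto simp: v_def)
    have P_less: "?P \<Phi> < v"
      if "\<Phi> \<in> C" "sum_tup M \<Phi> \<in> S" "\<forall>j<J. eta T nV nW M a b j \<Phi> \<le> 0" for \<Phi>
    proof -
      have "\<Phi> \<in> closure (Pfeas T nV nW M J a b TT)" unfolding feas using that by blast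
      then have "?P \<Phi> \<le> r" using le by blast
      then show ?thesis using v(1) by simp
    qed
    obtain \<Phi>r where "\<Phi>r \<in> closure (Pfeas T nV nW M J a b TT)" using ne closure_subset by blast
    then have \<Phi>r: "\<Phi>r \<in> C" "sum_tup M \<Phi>r \<in> S" "\<forall>j<J. eta T nV nW M a b j \<Phi>r \<le> 0"
      unfolding feas by blast+
    have "\<exists>p'\<in>Dfeas T nV nW M J c a C. Dobj T nV nW J b S p' \<le> v"
      by (rule strong_duality[OF T her _ _ _ C(2) _ _ S(2) \<Phi>r P_less]) (use C(1) S(1) in simp_all)
    then obtain p' where "p' \<in> Dfeas T nV nW M J c a C" "Dobj T nV nW J b S p' \<le> v" by blast
    moreover from this have "Dobj T nV nW J b S p \<le> Dobj T nV nW J b S p'" using opt by (simp add: Dopt_def)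
    ultimately show False using v(2) by simp
  qed
qed

text \<open>Every comb pairs to 1 with every element of \<open>SG\<close>, so \<open>chi\<close>
  pairs to the sum of its coefficients throughout, and the supremum is the same over any nonempty
  subset.\<close>

lemma lambdaS_lin_span_Chn:
  assumes T: "1 \<le> T" and chi: "chi \<in> lin_span (Chn T nV nW)"
    and S: "S \<noteq> {}" "S \<subseteq> S'" "S' \<subseteq> SG T nV nW"
  shows "lambdaS T nV nW S chi = lambdaS T nV nW S' chi"
proof -
  obtain F k where F: "F \<subseteq> Chn T nV nW" "chi = (\<lambda>i j. \<Sum>x\<in>F. scale_op (k x) x i j)"
    using chi by (auto simp: lin_span_def scale_op_def)
  have "inner_op (idxWV nV nW T) \<phi> chi = (\<Sum>x\<in>F. k x)" if "\<phi> \<in> SG T nV nW" for \<phi>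
  proof -
    have "inner_op (idxWV nV nW T) x \<phi> = 1" if "x \<in> F" for x
      using inner_op_cochains_combs[of \<phi> nV nW T 1 x 1] that F(1) T \<open>\<phi> \<in> _\<close> combs_Pos_Her
      by (auto simp: Chn_eq_combs SG_eq_cochains inner_op_commute)
    then show ?thesis
      unfolding inner_op_commute[of _ \<phi>] F(2) inner_op_sum_left inner_op_scale_left by simp
  qed
  then have "(\<lambda>\<phi>. inner_op (idxWV nV nW T) \<phi> chi) ` S = {\<Sum>x\<in>F. k x}"
    "(\<lambda>\<phi>. inner_op (idxWV nV nW T) \<phi> chi) ` S' = {\<Sum>x\<in>F. k x}"
    using S by (auto simp: image_iff subset_iff)
  then show ?thesis by (simp add: lambdaS_def)
qed

section \<open>Comparison of the two problems\<close>

lemma Dfeas_antimono: "C \<subseteq> C' \<Longrightarrow> Dfeas T nV nW M J c a C' \<subseteq> Dfeas T nV nW M J c a C"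
  by (auto simp: Dfeas_def dual_cone_def)

lemma Dfeas_upward:
  assumes her: "\<forall>m<M. Her (idxWV nV nW T) (c m)" "\<forall>j<J. \<forall>m<M. Her (idxWV nV nW T) (a j m)"
    and C: "C \<subseteq> CG T nV nW M" and feas: "(chi, q) \<in> Dfeas T nV nW M J c a C"
    and chi': "Her (idxWV nV nW T) chi'" "Pos (idxWV nV nW T) (diff_op chi' chi)"
  shows "(chi', q) \<in> Dfeas T nV nW M J c a C"
proof -
  let ?I = "idxWV nV nW T"
  have "0 \<le> inner_tup T nV nW M \<Phi> (\<lambda>m. if m < M then diff_op chi' (zq J c a q m) else zero_op)" if "\<Phi> \<in> C" for \<Phi>
  proof -
    have "0 \<le> inner_op ?I (sum_tup M \<Phi>) (diff_op chi' chi)"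
      unfolding inner_op_sum_tup using that C chi'(2)
      by (intro sum_nonneg inner_op_Pos_nonneg[OF finite_idxWV]) (auto simp: CG_def)
    moreover have "0 \<le> inner_tup T nV nW M \<Phi> (\<lambda>m. if m < M then diff_op chi (zq J c a q m) else zero_op)"
      using feas that by (auto simp: Dfeas_def dual_cone_def)
    ultimately show ?thesis unfolding inner_tup_dual_slack inner_op_diff_right by linarith
  qed
  then show ?thesis
    using feas chi'(1) HerM_dual_slack[OF her chi'(1)] by (auto simp: Dfeas_def dual_cone_def)
qed

theorem theorem3:
  fixes T M J :: nat
    and nV nW :: "nat \<Rightarrow> nat"
    and c :: "nat \<Rightarrow> op" and a :: "nat \<Rightarrow> nat \<Rightarrow> op" and b :: "nat \<Rightarrow> real"
    and T1 T2 C1 C2 :: "tup set" and S1 S2 :: "op set"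
  assumes T_pos: "1 \<le> T"
    and dims: "\<forall>t\<in>{1..T}. 0 < nV t \<and> 0 < nW t"
    and M_ge: "2 \<le> M"
    and c_her: "\<forall>m<M. Her (idxWV nV nW T) (c m)"
    and a_her: "\<forall>j<J. \<forall>m<M. Her (idxWV nV nW T) (a j m)"
    and T12: "T1 \<subseteq> T2" and T2G: "T2 \<subseteq> TG T nV nW M"
    and T1ne: "T1 \<noteq> {}" and T2ne: "T2 \<noteq> {}"
    and T1cvx: "convex_tups T1" and T2cvx: "convex_tups T2"
    and C1: "closed C1 \<and> convex_tups C1 \<and> cone_tups C1"
    and C2: "closed C2 \<and> convex_tups C2 \<and> cone_tups C2"
    and S1: "closed S1 \<and> convex_ops S1"
    and S2: "closed S2 \<and> convex_ops S2"
    and cl1: "closure T1 = {Phi \<in> C1. sum_tup M Phi \<in> S1}"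
    and cl2: "closure T2 = {Phi \<in> C2. sum_tup M Phi \<in> S2}"
    and C12: "C1 \<subseteq> C2" and C2G: "C2 \<subseteq> CG T nV nW M"
    and S12: "S1 \<subseteq> S2" and S2G: "S2 \<subseteq> SG T nV nW"
    and Pcl1: "closure (Pfeas T nV nW M J a b T1) =
                 {Phi \<in> closure T1. \<forall>j<J. eta T nV nW M a b j Phi \<le> 0}"
    and Pcl2: "closure (Pfeas T nV nW M J a b T2) =
                 {Phi \<in> closure T2. \<forall>j<J. eta T nV nW M a b j Phi \<le> 0}"
    and P1ne: "Pfeas T nV nW M J a b T1 \<noteq> {}"
    and D2opt: "\<exists>p. Dopt T nV nW M J c a b C2 S2 p"
  defines "st1 \<equiv> (Pval T nV nW M J c a b T1 = Pval T nV nW M J c a b T2)"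
    and "st2 \<equiv> (\<exists>chi q. Dopt T nV nW M J c a b C1 S1 (chi, q) \<and>
                  (chi, q) \<in> Dfeas T nV nW M J c a C2 \<and>
                  lambdaS T nV nW S1 chi = lambdaS T nV nW S2 chi)"
    and "st3 \<equiv> (\<forall>p. Dopt T nV nW M J c a b C2 S2 p \<longrightarrow> Dopt T nV nW M J c a b C1 S1 p)"
    and "st4 \<equiv> (\<exists>chi q. Dopt T nV nW M J c a b C1 S1 (chi, q) \<and>
                  (chi, q) \<in> Dfeas T nV nW M J c a C2 \<and>
                  chi \<in> lin_span (Chn T nV nW))"
  shows "(st1 \<longleftrightarrow> st2) \<and> (st2 \<longrightarrow> st3) \<and>
         (S2 = SG T nV nW \<longrightarrow> (st1 \<longleftrightarrow> st2) \<and> (st1 \<longleftrightarrow> st3) \<and> (st1 \<longleftrightarrow> st4))"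
proof -
  have S1ne: "S1 \<noteq> {}" using T1ne cl1 closure_subset[of T1] by auto
  have C1G: "C1 \<subseteq> CG T nV nW M" and S1G: "S1 \<subseteq> SG T nV nW" using C12 C2G S12 S2G by auto
  have Psub: "Pfeas T nV nW M J a b T1 \<subseteq> Pfeas T nV nW M J a b T2" using T12 by (auto simp: Pfeas_def)
  have P2ne: "Pfeas T nV nW M J a b T2 \<noteq> {}" using Psub P1ne by auto
  note value1 = Pval_eq_Dobj[OF T_pos c_her a_her C1 C1G S1 S1G cl1 Pcl1 P1ne]
  note value2 = Pval_eq_Dobj[OF T_pos c_her a_her C2 C2G S2 S2G cl2 Pcl2 P2ne]
  have Pval_le: "Pval T nV nW M J c a b T1 \<le> Pval T nV nW M J c a b T2"
    unfolding Pval_def by (rule SUP_subset_mono[OF Psub order_refl])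
  have Dfeas_sub: "Dfeas T nV nW M J c a C2 \<subseteq> Dfeas T nV nW M J c a C1" by (rule Dfeas_antimono[OF C12])
  have lam_le: "lambdaS T nV nW S1 chi \<le> lambdaS T nV nW S2 chi" for chi
    by (rule lambdaS_mono[OF T_pos S1ne S12 S2G])
  have D1_lower: "Pval T nV nW M J c a b T1 \<le> ereal (Dobj T nV nW J b S1 p)"
    if "p \<in> Dfeas T nV nW M J c a C1" for p
    unfolding Pval_def
  proof (rule SUP_least)
    fix \<Phi> assume "\<Phi> \<in> Pfeas T nV nW M J a b T1"
    then have "\<Phi> \<in> closure (Pfeas T nV nW M J a b T1)" using closure_subset by blast
    then show "ereal (Pobj T nV nW M c \<Phi>) \<le> ereal (Dobj T nV nW J b S1 p)"
      unfolding Pcl1 cl1 using weak_duality[OF T_pos S1G that] by auto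
  qed
  \<comment> \<open>The second dual objective at \<open>p\<close> equals the common primal value,
    which is a lower bound for the first dual objective; the latter is at most the former at
    \<open>p\<close>. Equality at \<open>p\<close> makes the support functions agree.\<close>
  have opt1: "Dopt T nV nW M J c a b C1 S1 p \<and> lambdaS T nV nW S1 (fst p) = lambdaS T nV nW S2 (fst p)"
    if st1 and p: "Dopt T nV nW M J c a b C2 S2 p" for p
  proof -
    have p2: "p \<in> Dfeas T nV nW M J c a C2" using p by (simp add: Dopt_def)
    then have p1: "p \<in> Dfeas T nV nW M J c a C1" using Dfeas_sub by blast
    have low: "ereal (Dobj T nV nW J b S2 p) \<le> ereal (Dobj T nV nW J b S1 p')"
      if "p' \<in> Dfeas T nV nW M J c a C1" for p'
      using D1_lower[OF that] value2[OF p] \<open>st1\<close> unfolding st1_def by simp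
    have "Dobj T nV nW J b S1 p \<le> Dobj T nV nW J b S2 p" using lam_le by (simp add: Dobj_def)
    then show ?thesis using low[OF p1] low p1 by (fastforce simp: Dopt_def Dobj_def)
  qed
  have 12: "st2" if st1
    using D2opt opt1[OF that] unfolding st2_def by (force simp: Dopt_def)
  have 21: "st1" if st2
  proof -
    obtain chi q where *: "Dopt T nV nW M J c a b C1 S1 (chi, q)" "(chi, q) \<in> Dfeas T nV nW M J c a C2"
      "lambdaS T nV nW S1 chi = lambdaS T nV nW S2 chi" using \<open>st2\<close> unfolding st2_def by blast
    obtain p where p: "Dopt T nV nW M J c a b C2 S2 p" using D2opt by blast
    have "Dobj T nV nW J b S2 p \<le> Dobj T nV nW J b S2 (chi, q)" using p *(2) by (simp add: Dopt_def)
    also have "\<dots> = Dobj T nV nW J b S1 (chi, q)" using *(3) by (simp add: Dobj_def)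
    finally have "Pval T nV nW M J c a b T2 \<le> Pval T nV nW M J c a b T1"
      using value1[OF *(1)] value2[OF p] by simp
    then show st1 unfolding st1_def using Pval_le by (rule antisym[rotated])
  qed
  have 13: "st3" if st1 using opt1[OF that] by (simp add: st3_def)
  have 42: "st2" if st4
    using that lambdaS_lin_span_Chn[OF T_pos _ S1ne S12 S2G] unfolding st4_def st2_def by blast
  have 34: "st4" if SG: "S2 = SG T nV nW" and st3
  proof -
    obtain chi q where opt: "Dopt T nV nW M J c a b C2 S2 (chi, q)" using D2opt by auto
    let ?l = "lambdaS T nV nW S2 chi"
    have feas: "(chi, q) \<in> Dfeas T nV nW M J c a C2" using opt by (simp add: Dopt_def)
    have "inner_op (idxWV nV nW T) \<phi> chi \<le> ?l" if "\<phi> \<in> cochains nV nW T 1" for \<phi>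
      using that SG T_pos by (intro inner_op_le_lambdaS) (auto simp: SG_eq_cochains)
    moreover have "Her (idxWV nV nW T) chi" using feas by (simp add: Dfeas_def)
    ultimately obtain Y where Y: "Y \<in> combs Her nV nW T ?l" "Pos (idxWV nV nW T) (diff_op Y chi)"
      using dominating_comb[OF dims] by blast
    have feasY: "(Y, q) \<in> Dfeas T nV nW M J c a C2"
      by (rule Dfeas_upward[OF c_her a_her C2G feas combs_Her[OF Y(1)] Y(2)])
    have "lambdaS T nV nW S2 Y \<le> ?l"
      using S1ne S12 inner_op_cochains_combs[OF _ Y(1)] SG T_pos
      by (intro lambdaS_le) (auto simp: SG_eq_cochains)
    then have "Dobj T nV nW J b S2 (Y, q) \<le> Dobj T nV nW J b S2 (chi, q)" by (simp add: Dobj_def)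
    \<comment> \<open>Optimality is established for the second dual first, since (3) speaks only of
      its optimal solutions; (3) then carries \<open>Y\<close> over to the first dual.\<close>
    then have "Dopt T nV nW M J c a b C2 S2 (Y, q)"
      using opt feasY by (force simp: Dopt_def)
    then have "Dopt T nV nW M J c a b C1 S1 (Y, q)" using \<open>st3\<close> by (simp add: st3_def)
    moreover have "Y \<in> lin_span (Chn T nV nW)" using combs_Her_subset_lin_span_Chn dims Y(1) by blast
    ultimately show st4 unfolding st4_def using feasY by blast
  qed
  show ?thesis using 12 21 13 42 34 by blast
qed

end
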